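(* With $\mathcal{A}$, $\mathcal{D}$, $L_0$, $\triangleright$, $[\cdot,\cdot]$ and $\diamond$ as defined in the context, $(\mathcal{A}\otimes\mathcal{D},\triangleright+\diamond)$ is a pre-Lie algebra, and $(L_0,\triangleright+\diamond)$ is a sub-pre-Lie algebra of it. These are respectively the $\diamond$-geometric post-Lie deformations of the post-Lie algebra $(\mathcal{A}\otimes\mathcal{D},\triangleright,[\cdot,\cdot])$ and of its sub-post-Lie algebra $(L_0,\triangleright,[\cdot,\cdot])$.
   Context: Pre-Lie and post-Lie. With $\mathsf{a}_\ast(x,y,z):=x\ast(y\ast z)-(x\ast y)\ast z$ and $[x,y]_\ast:=x\ast y-y\ast x$: $(L,\ast)$ is (left) pre-Lie if $\mathsf{a}_\ast(x,y,z)=\mathsf{a}_\ast(y,x,z)$; $(L,\triangleright,[\cdot,\cdot])$ is (left) post-Lie if $[\cdot,\cdot]$ is a Lie bracket, $x\triangleright[y,z]=[x\triangleright y,z]+[y,x\triangleright z]$ and $[x,y]\triangleright z=\mathsf{a}_\triangleright(x,y,z)-\mathsf{a}_\triangleright(y,x,z)$. A pre-Lie algebra is identified with a post-Lie algebra with zero bracket. Geometric post-Lie deformation. Let $(L,\triangleright,[\cdot,\cdot])$ be post-Lie and $\diamond$ a bilinear operation on $L$ such that for all $x,y,z$: $x\diamond(y\diamond z)-y\diamond(x\diamond z)-[x,y]\diamond z=0$ (null curvature); $x\diamond\mathbf{T}(y,z)=\mathbf{T}(x\diamond y,z)+\mathbf{T}(y,x\diamond z)$ where $\mathbf{T}(x,y)=[x,y]_\diamond-[x,y]$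 (constant torsion); and $x\triangleright(y\diamond z)=(x\triangleright y)\diamond z+y\diamond(x\triangleright z)$. The $\diamond$-geometric post-Lie deformation is $(L,\triangleright+\diamond,[\cdot,\cdot]-[\cdot,\cdot]_\diamond)$. Setting. Let $\mathbb{N}=\{0,1,\dots\}$, $d\ge1$, $\mathbb{N}^d_*=\mathbb{N}^d\setminus\{\mathbf 0\}$, $\mathbf e_1,\dots,\mathbf e_d$ the canonical basis vectors of $\mathbb{N}^d$. $\mathcal{A}:=\mathbb{R}[\mathsf z_k,\mathsf z_{\mathbf n}]_{k\in\mathbb{N},\mathbf n\in\mathbb{N}^d_*}$ is the polynomial algebra with unit $\mathbf 1$. $\mathcal{M}$ is the set of finitely supported $\gamma:\mathbb{N}\sqcup\mathbb{N}^d_*\to\mathbb{N}$, and $\mathsf z^\gamma:=\prod_i\mathsf z_i^{\gamma_i}$. Derivations of $\mathcal{A}$: $D^{(\mathbf 0)}:=\sum_{k\ge0}(k+1)\mathsf z_{k+1}\partial_{\mathsf z_k}$, $D^{(\mathbf n)}:=\partial_{\mathsf z_{\mathbf n}}$ for $\mathbf n\in\mathbb{N}^d_*$, and $\partial_i:=\sum_{\mathbf n\in\mathbb{N}^d}(n_i+1)\mathsf z_{\mathbf n+\mathbf e_i}D^{(\mathbf n)}$ for $i\in\{1,\dots,d\}$. $\mathcal{D}$ is the linear span of $\{\partial_i\}_{1\le i\le d}\cup\{D^{(\mathbf n)}\}_{\mathbf n\in\mathbb{N}^d}$, which is a linear basis of $\mathcal{D}$; $\mathcal{D}$ is stable under the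 commutator $[\cdot,\cdot]_\circ$ of composition. On $\mathcal{A}\otimes\mathcal{D}$: $(a_1\otimes D_1)\triangleright(a_2\otimes D_2):=a_1D_1(a_2)\otimes D_2$ and $[a_1\otimes D_1,a_2\otimes D_2]:=a_1a_2\otimes[D_1,D_2]_\circ$; $(\mathcal{A}\otimes\mathcal{D},\triangleright,[\cdot,\cdot])$ is known to be post-Lie. The subspace $L_0$ spanned by $\mathbf 1\otimes\partial_i$ ($1\le i\le d$) and $\mathsf z^\gamma\otimes D^{(\mathbf n)}$ ($\gamma\in\mathcal{M}$, $\mathbf n\in\mathbb{N}^d$) is known to be a sub-post-Lie algebra. The operation $\diamond$ on $\mathcal{D}$ is defined on the basis by $D^{(\mathbf n)}\diamond D^{(\mathbf n')}=0$, $\partial_i\diamond\partial_j=0$, $D^{(\mathbf n)}\diamond\partial_i=0$, $\partial_i\diamond D^{(\mathbf n)}=-n_iD^{(\mathbf n-\mathbf e_i)}$ (zero if $n_i=0$), and extended to $\mathcal{A}\otimes\mathcal{D}$ by $(a_1\otimes D_1)\diamond(a_2\otimes D_2):=a_1a_2\otimes(D_1\diamond D_2)$. *)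

theory Defs
  imports
    "HOL-Analysis.Analysis"
    "HOL-Analysis.Finite_Function_Topology"
    "HOL-Library.Function_Algebras"
begin

section \<open>Real vector space preliminaries\<close>

lemma lookup_scaleR [simp]:
  "Poly_Mapping.lookup (c *\<^sub>R p) k = c *\<^sub>R Poly_Mapping.lookup p k"
  unfolding scaleR_poly_mapping_def
  by (subst lookup_Abs_poly_mapping) (auto intro: finite_subset[OF _ finite_lookup[of p]])

lemma scaleR_conv_mult:
  fixes p :: "'a::monoid_add \<Rightarrow>\<^sub>0 'b::real_algebra_1"
  shows "c *\<^sub>R p = Poly_Mapping.single 0 (of_real c) * p"
  unfolding mult_map_scale_conv_mult[symmetric]
  by (rule poly_mapping_eqI) (simp add: Poly_Mapping.map.rep_eq when_def scaleR_conv_of_real)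

instance poly_mapping :: (comm_monoid_add, "{real_algebra_1, comm_ring_1}") real_algebra_1
proof
  fix c :: real and p q :: "'a \<Rightarrow>\<^sub>0 'b"
  show "c *\<^sub>R p * q = c *\<^sub>R (p * q)" and "p * c *\<^sub>R q = c *\<^sub>R (p * q)"
    by (simp_all add: scaleR_conv_mult mult_ac)
qed

instantiation "fun" :: (type, real_vector) real_vector
begin

definition scaleR_fun :: "real \<Rightarrow> ('a \<Rightarrow> 'b) \<Rightarrow> 'a \<Rightarrow> 'b"
  where "scaleR_fun c f = (\<lambda>x. c *\<^sub>R f x)"

instance
  by standard (auto simp: scaleR_fun_def fun_eq_iff algebra_simps)

end

lemma scaleR_fun_apply [simp]: "(c *\<^sub>R f) x = c *\<^sub>R f x"
  by (simp add: scaleR_fun_def)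

text \<open>The library's \<^const>\<open>bilinear\<close> concerns whole types; the notions below concern an
  operation restricted to a subspace that it preserves.\<close>

definition bilinear_op_on :: "'v::real_vector set \<Rightarrow> ('v \<Rightarrow> 'v \<Rightarrow> 'v) \<Rightarrow> bool" where
  "bilinear_op_on L f \<longleftrightarrow> subspace L \<and>
     (\<forall>x\<in>L. \<forall>y\<in>L. f x y \<in> L) \<and>
     (\<forall>x\<in>L. \<forall>y\<in>L. \<forall>z\<in>L. f (x + y) z = f x z + f y z \<and> f z (x + y) = f z x + f z y) \<and>
     (\<forall>c. \<forall>x\<in>L. \<forall>y\<in>L. f (c *\<^sub>R x) y = c *\<^sub>R f x y \<and> f x (c *\<^sub>R y) = c *\<^sub>R f x y)"

section \<open>Pre-Lie and post-Lie algebras, geometric deformations\<close>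

definition associator :: "('v::real_vector \<Rightarrow> 'v \<Rightarrow> 'v) \<Rightarrow> 'v \<Rightarrow> 'v \<Rightarrow> 'v \<Rightarrow> 'v" where
  "associator f x y z = f x (f y z) - f (f x y) z"

definition commutator :: "('v::real_vector \<Rightarrow> 'v \<Rightarrow> 'v) \<Rightarrow> 'v \<Rightarrow> 'v \<Rightarrow> 'v" where
  "commutator f x y = f x y - f y x"

definition pre_lie_on :: "'v::real_vector set \<Rightarrow> ('v \<Rightarrow> 'v \<Rightarrow> 'v) \<Rightarrow> bool" where
  "pre_lie_on L f \<longleftrightarrow> bilinear_op_on L f \<and>
     (\<forall>x\<in>L. \<forall>y\<in>L. \<forall>z\<in>L. associator f x y z = associator f y x z)"

definition sub_pre_lie :: "'v::real_vector set \<Rightarrow> 'v set \<Rightarrow> ('v \<Rightarrow> 'v \<Rightarrow> 'v) \<Rightarrow> bool" where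
  "sub_pre_lie M L f \<longleftrightarrow> pre_lie_on L f \<and> subspace M \<and> M \<subseteq> L \<and> (\<forall>x\<in>M. \<forall>y\<in>M. f x y \<in> M)"

definition lie_bracket_on :: "'v::real_vector set \<Rightarrow> ('v \<Rightarrow> 'v \<Rightarrow> 'v) \<Rightarrow> bool" where
  "lie_bracket_on L br \<longleftrightarrow> bilinear_op_on L br \<and> (\<forall>x\<in>L. br x x = 0) \<and>
     (\<forall>x\<in>L. \<forall>y\<in>L. \<forall>z\<in>L. br x (br y z) + br y (br z x) + br z (br x y) = 0)"

definition post_lie_on ::
  "'v::real_vector set \<Rightarrow> ('v \<Rightarrow> 'v \<Rightarrow> 'v) \<Rightarrow> ('v \<Rightarrow> 'v \<Rightarrow> 'v) \<Rightarrow> bool" where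
  "post_lie_on L tri br \<longleftrightarrow> lie_bracket_on L br \<and> bilinear_op_on L tri \<and>
     (\<forall>x\<in>L. \<forall>y\<in>L. \<forall>z\<in>L. tri x (br y z) = br (tri x y) z + br y (tri x z)) \<and>
     (\<forall>x\<in>L. \<forall>y\<in>L. \<forall>z\<in>L. tri (br x y) z = associator tri x y z - associator tri y x z)"

definition sub_post_lie ::
  "'v::real_vector set \<Rightarrow> 'v set \<Rightarrow> ('v \<Rightarrow> 'v \<Rightarrow> 'v) \<Rightarrow> ('v \<Rightarrow> 'v \<Rightarrow> 'v) \<Rightarrow> bool" where
  "sub_post_lie M L tri br \<longleftrightarrow> post_lie_on L tri br \<and> subspace M \<and> M \<subseteq> L \<and>
     (\<forall>x\<in>M. \<forall>y\<in>M. tri x y \<in> M) \<and> (\<forall>x\<in>M. \<forall>y\<in>M. br x y \<in> M)"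

definition torsion ::
  "('v::real_vector \<Rightarrow> 'v \<Rightarrow> 'v) \<Rightarrow> ('v \<Rightarrow> 'v \<Rightarrow> 'v) \<Rightarrow> 'v \<Rightarrow> 'v \<Rightarrow> 'v" where
  "torsion br dia x y = commutator dia x y - br x y"

text \<open>\<open>geometric_deformation L tri br dia tri' br'\<close>: the triple \<open>(L, tri, br)\<close> is post-Lie, the
  operation \<open>dia\<close> on \<open>L\<close> meets the requirements (null curvature, constant torsion, \<open>tri\<close> acting
  on \<open>dia\<close> by derivations), and \<open>(L, tri', br')\<close> is the \<open>dia\<close>-geometric post-Lie deformation.\<close>

definition geometric_deformation ::
  "'v::real_vector set \<Rightarrow> ('v \<Rightarrow> 'v \<Rightarrow> 'v) \<Rightarrow> ('v \<Rightarrow> 'v \<Rightarrow> 'v) \<Rightarrow> ('v \<Rightarrow> 'v \<Rightarrow> 'v)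
     \<Rightarrow> ('v \<Rightarrow> 'v \<Rightarrow> 'v) \<Rightarrow> ('v \<Rightarrow> 'v \<Rightarrow> 'v) \<Rightarrow> bool" where
  "geometric_deformation L tri br dia tri' br' \<longleftrightarrow>
     post_lie_on L tri br \<and> bilinear_op_on L dia \<and>
     (\<forall>x\<in>L. \<forall>y\<in>L. \<forall>z\<in>L. dia x (dia y z) - dia y (dia x z) - dia (br x y) z = 0) \<and>
     (\<forall>x\<in>L. \<forall>y\<in>L. \<forall>z\<in>L. dia x (torsion br dia y z)
        = torsion br dia (dia x y) z + torsion br dia y (dia x z)) \<and>
     (\<forall>x\<in>L. \<forall>y\<in>L. \<forall>z\<in>L. tri x (dia y z) = dia (tri x y) z + dia y (tri x z)) \<and>
     (\<forall>x\<in>L. \<forall>y\<in>L. tri' x y = tri x y + dia x y) \<and>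
     (\<forall>x\<in>L. \<forall>y\<in>L. br' x y = br x y - commutator dia x y)"

section \<open>Tensor product of real vector spaces\<close>

text \<open>The free vector space on pairs modulo the span of the bilinearity relations.\<close>

definition pure :: "'a \<Rightarrow> 'b \<Rightarrow> ('a \<times> 'b) \<Rightarrow>\<^sub>0 real" where
  "pure a b = Poly_Mapping.single (a, b) 1"

definition tensor_relations :: "(('a::real_vector \<times> 'b::real_vector) \<Rightarrow>\<^sub>0 real) set" where
  "tensor_relations =
     {pure (a + a') b - pure a b - pure a' b | a a' b. True} \<union>
     {pure a (b + b') - pure a b - pure a b' | a b b'. True} \<union>
     {pure (c *\<^sub>R a) b - c *\<^sub>R pure a b | c a b. True} \<union>
     {pure a (c *\<^sub>R b) - c *\<^sub>R pure a b | c a b. True}"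

definition tensor_eq ::
  "(('a::real_vector \<times> 'b::real_vector) \<Rightarrow>\<^sub>0 real) \<Rightarrow> (('a \<times> 'b) \<Rightarrow>\<^sub>0 real) \<Rightarrow> bool" where
  "tensor_eq u v \<longleftrightarrow> u - v \<in> span tensor_relations"

quotient_type (overloaded) ('a, 'b) tensor =
  "('a::real_vector \<times> 'b::real_vector) \<Rightarrow>\<^sub>0 real" / tensor_eq
proof (rule equivpI)
  show "reflp tensor_eq"
    by (auto simp: reflp_def tensor_eq_def intro: span_zero)
  show "symp tensor_eq"
    unfolding symp_def tensor_eq_def using span_neg by fastforce
  show "transp tensor_eq"
    unfolding transp_def tensor_eq_def using span_add by fastforce
qed

instantiation tensor :: (real_vector, real_vector) real_vector
begin

lift_definition zero_tensor :: "('a, 'b) tensor" is 0 .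

lift_definition plus_tensor :: "('a, 'b) tensor \<Rightarrow> ('a, 'b) tensor \<Rightarrow> ('a, 'b) tensor" is "(+)"
  unfolding tensor_eq_def by (simp only: add_diff_add span_add)

lift_definition minus_tensor :: "('a, 'b) tensor \<Rightarrow> ('a, 'b) tensor \<Rightarrow> ('a, 'b) tensor" is "(-)"
  unfolding tensor_eq_def by (drule (1) span_diff) (simp add: algebra_simps)

lift_definition uminus_tensor :: "('a, 'b) tensor \<Rightarrow> ('a, 'b) tensor" is uminus
  unfolding tensor_eq_def by (drule span_neg) (simp add: algebra_simps)

lift_definition scaleR_tensor :: "real \<Rightarrow> ('a, 'b) tensor \<Rightarrow> ('a, 'b) tensor" is scaleR
  unfolding tensor_eq_def by (simp only: span_scale flip: real_vector.scale_right_diff_distrib)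

instance
  by standard (transfer; simp add: tensor_eq_def span_zero algebra_simps)+

end

lift_definition tensor_of :: "'a::real_vector \<Rightarrow> 'b::real_vector \<Rightarrow> ('a, 'b) tensor"  (infixl "\<otimes>" 73)
  is pure .

text \<open>Linear extension to the tensor product of a bilinear map. By \<open>tensor_lift_of\<close>
  below, the choice of representative \<^const>\<open>rep_tensor\<close> is immaterial when \<open>f\<close> is bilinear.\<close>

definition free_lift :: "('a \<Rightarrow> 'b \<Rightarrow> 'c::real_vector) \<Rightarrow> (('a \<times> 'b) \<Rightarrow>\<^sub>0 real) \<Rightarrow> 'c" where
  "free_lift f u = (\<Sum>(a, b)\<in>Poly_Mapping.keys u. Poly_Mapping.lookup u (a, b) *\<^sub>R f a b)"

definition tensor_lift ::
  "('a::real_vector \<Rightarrow> 'b::real_vector \<Rightarrow> 'c::real_vector) \<Rightarrow> ('a, 'b) tensor \<Rightarrow> 'c" where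
  "tensor_lift f t = free_lift f (rep_tensor t)"

definition tensor_lift2 ::
  "('a::real_vector \<Rightarrow> 'b::real_vector \<Rightarrow> 'c::real_vector \<Rightarrow> 'd::real_vector \<Rightarrow> 'e::real_vector)
     \<Rightarrow> ('a, 'b) tensor \<Rightarrow> ('c, 'd) tensor \<Rightarrow> 'e" where
  "tensor_lift2 f s t = tensor_lift (\<lambda>a b. tensor_lift (\<lambda>c d. f a b c d) t) s"


lemma free_lift_eq_sum:
  assumes "finite K" "Poly_Mapping.keys u \<subseteq> K"
  shows "free_lift f u = (\<Sum>(a, b)\<in>K. Poly_Mapping.lookup u (a, b) *\<^sub>R f a b)"
  unfolding free_lift_def using assms
  by (intro sum.mono_neutral_left) (auto simp: in_keys_iff)

lemma linear_free_lift: "linear (free_lift f)"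
proof (rule linearI)
  fix u v :: "('a \<times> 'b) \<Rightarrow>\<^sub>0 real"
  let ?K = "Poly_Mapping.keys u \<union> Poly_Mapping.keys v"
  have "Poly_Mapping.keys (u + v) \<subseteq> ?K" by (rule keys_add)
  then show "free_lift f (u + v) = free_lift f u + free_lift f v"
    by (simp add: free_lift_eq_sum[of ?K] lookup_add scaleR_left_distrib sum.distrib split_def)
next
  fix c and u :: "('a \<times> 'b) \<Rightarrow>\<^sub>0 real"
  have "Poly_Mapping.keys (c *\<^sub>R u) \<subseteq> Poly_Mapping.keys u" by (auto simp: in_keys_iff)
  then show "free_lift f (c *\<^sub>R u) = c *\<^sub>R free_lift f u"
    by (simp add: free_lift_eq_sum[of "Poly_Mapping.keys u"] scaleR_sum_right split_def)
qed

lemma free_lift_pure: "free_lift f (pure a b) = f a b"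
  by (simp add: free_lift_def pure_def)

lemma free_lift_cong:
  assumes "bilinear f" "tensor_eq u v"
  shows "free_lift f u = free_lift f v"
proof -
  interpret linear "free_lift f" by (rule linear_free_lift)
  have "free_lift f w = 0" if "w \<in> span tensor_relations" for w
    using that
  proof (induction rule: span_induct)
    case base
    show ?case by (auto simp: subspace_def add scale)
  next
    case (step w)
    then show ?case
      using assms(1) unfolding tensor_relations_def
      by (auto simp: diff scale free_lift_pure bilinear_ladd bilinear_radd bilinear_lmul bilinear_rmul)
  qed
  with assms(2) have "free_lift f (u - v) = 0" by (simp add: tensor_eq_def)
  then show ?thesis by (simp add: diff)
qed

lemma tensor_lift_abs:
  assumes "bilinear f"
  shows "tensor_lift f (abs_tensor u) = free_lift f u"
proof -
  have "tensor_eq u u" by (simp add: tensor_eq_def span_zero)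
  then have "tensor_eq (rep_tensor (abs_tensor u)) u"
    by (rule rep_abs_rsp_left[OF Quotient3_tensor])
  then show ?thesis unfolding tensor_lift_def by (rule free_lift_cong[OF assms])
qed

lemma bilinear_tensor_of: "bilinear (\<otimes>)"
proof -
  have "(a + a') \<otimes> b = a \<otimes> b + a' \<otimes> b" for a a' :: 'a and b :: 'b
  proof transfer
    fix a a' :: 'a and b :: 'b
    have "pure (a + a') b - pure a b - pure a' b \<in> tensor_relations"
      unfolding tensor_relations_def by blast
    then show "tensor_eq (pure (a + a') b) (pure a b + pure a' b)"
      unfolding tensor_eq_def by (simp only: diff_diff_eq span_base)
  qed
  moreover have "a \<otimes> (b + b') = a \<otimes> b + a \<otimes> b'" for a :: 'a and b b' :: 'b
  proof transfer
    fix a :: 'a and b b' :: 'b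
    have "pure a (b + b') - pure a b - pure a b' \<in> tensor_relations"
      unfolding tensor_relations_def by blast
    then show "tensor_eq (pure a (b + b')) (pure a b + pure a b')"
      unfolding tensor_eq_def by (simp only: diff_diff_eq span_base)
  qed
  moreover have "(c *\<^sub>R a) \<otimes> b = c *\<^sub>R (a \<otimes> b)" for c and a :: 'a and b :: 'b
  proof transfer
    fix c and a :: 'a and b :: 'b
    have "pure (c *\<^sub>R a) b - c *\<^sub>R pure a b \<in> tensor_relations"
      unfolding tensor_relations_def by blast
    then show "tensor_eq (pure (c *\<^sub>R a) b) (c *\<^sub>R pure a b)"
      unfolding tensor_eq_def by (rule span_base)
  qed
  moreover have "a \<otimes> (c *\<^sub>R b) = c *\<^sub>R (a \<otimes> b)" for c and a :: 'a and b :: 'b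
  proof transfer
    fix c and a :: 'a and b :: 'b
    have "pure a (c *\<^sub>R b) - c *\<^sub>R pure a b \<in> tensor_relations"
      unfolding tensor_relations_def by blast
    then show "tensor_eq (pure a (c *\<^sub>R b)) (c *\<^sub>R pure a b)"
      unfolding tensor_eq_def by (rule span_base)
  qed
  ultimately show ?thesis
    by (simp add: bilinear_def linear_iff)
qed

lemma tensor_lift_of: "bilinear f \<Longrightarrow> tensor_lift f (a \<otimes> b) = f a b"
  unfolding tensor_of_def by (simp add: tensor_lift_abs free_lift_pure)

lemma linear_tensor_lift:
  assumes "bilinear f"
  shows "linear (tensor_lift f)"
proof (rule linearI)
  interpret linear "free_lift f" by (rule linear_free_lift)
  show "tensor_lift f (s + t) = tensor_lift f s + tensor_lift f t" for s t
    by (induct s rule: tensor.abs_induct, induct t rule: tensor.abs_induct)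
      (simp add: plus_tensor.abs_eq tensor_lift_abs[OF assms] add)
  show "tensor_lift f (c *\<^sub>R t) = c *\<^sub>R tensor_lift f t" for c t
    by (induct t rule: tensor.abs_induct)
      (simp add: scaleR_tensor.abs_eq tensor_lift_abs[OF assms] scale)
qed

lemma tensor_lift_linear_param:
  "tensor_lift (\<lambda>a b. f a b + g a b) t = tensor_lift f t + tensor_lift g t"
  "tensor_lift (\<lambda>a b. c *\<^sub>R f a b) t = c *\<^sub>R tensor_lift f t"
  by (simp_all add: tensor_lift_def free_lift_def split_def scaleR_right_distrib sum.distrib
      scaleR_sum_right mult.commute[of c])

context
  fixes f :: "'a::real_vector \<Rightarrow> 'b::real_vector \<Rightarrow> 'c::real_vector \<Rightarrow> 'd::real_vector \<Rightarrow> 'e::real_vector"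
  assumes f1: "\<And>c d. bilinear (\<lambda>a b. f a b c d)" and f2: "\<And>a b. bilinear (f a b)"
begin

lemma bilinear_tensor_lift2_aux: "bilinear (\<lambda>a b. tensor_lift (\<lambda>c d. f a b c d) t)"
proof -
  have "f (a + a') b = (\<lambda>c d. f a b c d + f a' b c d)" "f a (b + b') = (\<lambda>c d. f a b c d + f a b' c d)"
    "f (r *\<^sub>R a) b = (\<lambda>c d. r *\<^sub>R f a b c d)" "f a (r *\<^sub>R b) = (\<lambda>c d. r *\<^sub>R f a b c d)"
    for a a' b b' r
    by (intro ext; rule bilinear_ladd[OF f1] bilinear_radd[OF f1] bilinear_lmul[OF f1] bilinear_rmul[OF f1])+
  then show ?thesis
    unfolding bilinear_def linear_iff by (simp add: tensor_lift_linear_param)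
qed

lemma tensor_lift2_of: "tensor_lift2 f (a \<otimes> b) (c \<otimes> d) = f a b c d"
  unfolding tensor_lift2_def
  by (rule trans[OF tensor_lift_of[OF bilinear_tensor_lift2_aux] tensor_lift_of[OF f2]])

lemma bilinear_tensor_lift2: "bilinear (tensor_lift2 f)"
proof -
  have "linear (\<lambda>s. tensor_lift2 f s t)" for t
    unfolding tensor_lift2_def using linear_tensor_lift[OF bilinear_tensor_lift2_aux] .
  moreover have "linear (\<lambda>t. tensor_lift2 f s t)" for s
  proof -
    have "linear (tensor_lift (f a b))" for a b
      by (rule linear_tensor_lift[OF f2])
    then show ?thesis
      unfolding tensor_lift2_def linear_iff by (simp add: tensor_lift_linear_param)
  qed
  ultimately show ?thesis by (simp add: bilinear_def)
qed

end

section \<open>The polynomial algebra and its derivations\<close>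

typedef (overloaded) ('d::finite) nonzero_index = "{n :: nat ^ 'd. n \<noteq> 0}"
proof
  show "(\<chi> i. 1) \<in> {n :: nat ^ 'd. n \<noteq> 0}" by (simp add: vec_eq_iff)
qed

text \<open>The coordinates of \<open>\<nat>\<^sup>d\<close> are indexed by a finite type \<open>'d\<close>, so \<open>d = CARD('d) \<ge> 1\<close>; the canonical
  basis vector \<open>e\<^sub>i\<close> is \<^term>\<open>axis i 1\<close>. The index \<open>Inl k\<close> stands for the variable \<open>z\<^sub>k\<close>, and \<open>Inr\<close> for the variables
  indexed by the nonzero multi-indices. A monomial exponent is a finitely supported
  \<open>'d var \<Rightarrow>\<^sub>0 nat\<close>, and a polynomial is a finitely supported family of coefficients.\<close>

type_synonym 'd var = "nat + 'd nonzero_index"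
type_synonym 'd mpoly = "('d var \<Rightarrow>\<^sub>0 nat) \<Rightarrow>\<^sub>0 real"

definition X :: "'v \<Rightarrow> ('v \<Rightarrow>\<^sub>0 nat) \<Rightarrow>\<^sub>0 real" where
  "X v = Poly_Mapping.single (Poly_Mapping.single v 1) 1"

definition zk :: "nat \<Rightarrow> ('d::finite) mpoly" where
  "zk k = X (Inl k)"

text \<open>Meaningful only for \<open>n \<noteq> 0\<close>.\<close>

definition zn :: "nat ^ 'd \<Rightarrow> ('d::finite) mpoly" where
  "zn n = X (Inr (Abs_nonzero_index n))"

definition zmon :: "('v \<Rightarrow>\<^sub>0 nat) \<Rightarrow> ('v \<Rightarrow>\<^sub>0 nat) \<Rightarrow>\<^sub>0 real" where
  "zmon \<gamma> = (\<Prod>v\<in>Poly_Mapping.keys \<gamma>. X v ^ Poly_Mapping.lookup \<gamma> v)"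

text \<open>Partial derivative with respect to the variable \<open>v\<close>. The truncated subtraction of exponents
  is harmless: it truncates only for monomials free of \<open>v\<close>, whose coefficient is \<open>0\<close>.\<close>

definition pd :: "'v \<Rightarrow> (('v \<Rightarrow>\<^sub>0 nat) \<Rightarrow>\<^sub>0 real) \<Rightarrow> (('v \<Rightarrow>\<^sub>0 nat) \<Rightarrow>\<^sub>0 real)" where
  "pd v p = (\<Sum>m\<in>Poly_Mapping.keys p. Poly_Mapping.single (m - Poly_Mapping.single v 1)
      (real (Poly_Mapping.lookup m v) * Poly_Mapping.lookup p m))"

text \<open>\<^const>\<open>Sum_any\<close> sums over the indices with a nonzero summand; there are finitely many of them
  by \<open>finite_D_op_0\<close> and \<open>finite_partial_op\<close> below.\<close>

text \<open>\<open>D_op n\<close> is the operator \<open>D\<close> with superscript \<open>n\<close>; \<open>n = 0\<close> is the special case.\<close>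

definition D_op :: "nat ^ 'd \<Rightarrow> ('d::finite) mpoly \<Rightarrow> 'd mpoly" where
  "D_op n p = (if n = 0 then Sum_any (\<lambda>k. real (k + 1) *\<^sub>R (zk (k + 1) * pd (Inl k) p))
     else pd (Inr (Abs_nonzero_index n)) p)"

definition partial_op :: "'d \<Rightarrow> ('d::finite) mpoly \<Rightarrow> 'd mpoly" where
  "partial_op i p = Sum_any (\<lambda>n. real (n $ i + 1) *\<^sub>R (zn (n + axis i 1) * D_op n p))"

definition generator_op :: "'d + (nat ^ 'd) \<Rightarrow> ('d::finite) mpoly \<Rightarrow> 'd mpoly" where
  "generator_op = case_sum partial_op D_op"

subsection \<open>Derivations\<close>

definition is_derivation :: "('a::real_algebra \<Rightarrow> 'a) \<Rightarrow> bool" where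
  "is_derivation f \<longleftrightarrow> linear f \<and> (\<forall>p q. f (p * q) = f p * q + p * f q)"

lemma is_derivationD:
  assumes "is_derivation f"
  shows "linear f" "f (p + q) = f p + f q" "f (p - q) = f p - f q" "f (- p) = - f p" "f 0 = 0"
    "f (c *\<^sub>R p) = c *\<^sub>R f p" "f (p * q) = f p * q + p * f q"
  using assms by (auto simp: is_derivation_def linear_add linear_diff linear_neg linear_0 linear_cmul)

lemma subspace_derivations: "subspace {f :: 'a::real_algebra \<Rightarrow> 'a. is_derivation f}"
  unfolding subspace_def
proof (intro conjI ballI allI; simp only: mem_Collect_eq)
  show "is_derivation (0 :: 'a \<Rightarrow> 'a)"
    by (simp add: is_derivation_def linear_iff)
next
  fix f g :: "'a \<Rightarrow> 'a"
  assume "is_derivation f" "is_derivation g"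
  then show "is_derivation (f + g)"
    unfolding is_derivation_def by (simp add: linear_iff ring_distribs scaleR_right_distrib)
next
  fix c and f :: "'a \<Rightarrow> 'a"
  assume "is_derivation f"
  then show "is_derivation (c *\<^sub>R f)"
    unfolding is_derivation_def by (simp add: linear_iff ring_distribs scaleR_right_distrib)
qed

lemma is_derivation_commutator:
  assumes f: "is_derivation f" and g: "is_derivation g"
  shows "is_derivation ((f \<circ> g) - (g \<circ> f))"
  using is_derivationD(2,6,7)[OF f] is_derivationD(2,6,7)[OF g]
  by (simp add: is_derivation_def linear_iff ring_distribs scaleR_diff_right)

lemma mpoly_expand:
  fixes p :: "'m \<Rightarrow>\<^sub>0 real"
  shows "p = (\<Sum>m\<in>Poly_Mapping.keys p. Poly_Mapping.lookup p m *\<^sub>R Poly_Mapping.single m 1)"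
  by (rule poly_mapping_eqI)
    (auto simp: lookup_sum lookup_single when_def in_keys_iff sum.delta' if_distrib cong: if_cong)

lemma linear_eq_mpoly:
  fixes f g :: "('m \<Rightarrow>\<^sub>0 real) \<Rightarrow> 'b::real_vector"
  assumes "linear f" "linear g" "\<And>m. f (Poly_Mapping.single m 1) = g (Poly_Mapping.single m 1)"
  shows "f = g"
proof
  fix p
  show "f p = g p"
    by (subst (1 2) mpoly_expand) (simp add: linear_sum assms linear_cmul)
qed

lemma pd_eq_sum:
  assumes "finite K" "Poly_Mapping.keys p \<subseteq> K"
  shows "pd v p = (\<Sum>m\<in>K. Poly_Mapping.single (m - Poly_Mapping.single v 1)
      (real (Poly_Mapping.lookup m v) * Poly_Mapping.lookup p m))"
  unfolding pd_def using assms
  by (intro sum.mono_neutral_left) (auto simp: in_keys_iff)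

lemma linear_pd: "linear (pd v)"
proof (rule linearI)
  fix p q :: "('a \<Rightarrow>\<^sub>0 nat) \<Rightarrow>\<^sub>0 real"
  let ?K = "Poly_Mapping.keys p \<union> Poly_Mapping.keys q"
  have "Poly_Mapping.keys (p + q) \<subseteq> ?K" by (rule keys_add)
  then show "pd v (p + q) = pd v p + pd v q"
    by (simp add: pd_eq_sum[of ?K] lookup_add ring_distribs sum.distrib single_add)
next
  fix c and p :: "('a \<Rightarrow>\<^sub>0 nat) \<Rightarrow>\<^sub>0 real"
  have "Poly_Mapping.keys (c *\<^sub>R p) \<subseteq> Poly_Mapping.keys p" by (auto simp: in_keys_iff)
  moreover have "Poly_Mapping.single k (c * a) = c *\<^sub>R Poly_Mapping.single k a"
    for k :: "'a \<Rightarrow>\<^sub>0 nat" and a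
    by (rule poly_mapping_eqI) (simp add: lookup_single when_def)
  ultimately show "pd v (c *\<^sub>R p) = c *\<^sub>R pd v p"
    by (simp add: pd_eq_sum[of "Poly_Mapping.keys p"] scaleR_sum_right mult.left_commute)
qed

lemma pd_single:
  "pd v (Poly_Mapping.single m c) =
     Poly_Mapping.single (m - Poly_Mapping.single v 1) (real (Poly_Mapping.lookup m v) * c)"
  by (subst pd_eq_sum[of "{m}"]) auto

lemma pd_X: "pd v (X w) = (if v = w then 1 else 0)"
  by (auto simp: X_def pd_single lookup_single)

lemma is_derivation_on_monomials:
  fixes f :: "(('v \<Rightarrow>\<^sub>0 nat) \<Rightarrow>\<^sub>0 real) \<Rightarrow> ('v \<Rightarrow>\<^sub>0 nat) \<Rightarrow>\<^sub>0 real"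
  assumes f: "linear f"
    and mon: "\<And>m m'. f (Poly_Mapping.single (m + m') 1) =
      f (Poly_Mapping.single m 1) * Poly_Mapping.single m' 1 + Poly_Mapping.single m 1 * f (Poly_Mapping.single m' 1)"
  shows "is_derivation f"
proof -
  let ?s = "\<lambda>m. Poly_Mapping.single m 1 :: ('v \<Rightarrow>\<^sub>0 nat) \<Rightarrow>\<^sub>0 real"
  have l1: "linear (\<lambda>q. f (p * q))" and l2: "linear (\<lambda>q. f (q * p))"
    and l3: "linear (\<lambda>q. f p * q + p * f q)" and l4: "linear (\<lambda>q. f q * p + q * f p)" for p
    using f by (simp_all add: linear_iff algebra_simps)
  have "(\<lambda>q. f (?s m * q)) = (\<lambda>q. f (?s m) * q + ?s m * f q)" for m
    by (rule linear_eq_mpoly[OF l1 l3]) (simp add: mult_single mon)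
  then have *: "f (?s m * q) = f (?s m) * q + ?s m * f q" for m q
    by meson
  have "(\<lambda>p. f (p * q)) = (\<lambda>p. f p * q + p * f q)" for q
    by (rule linear_eq_mpoly[OF l2 l4]) (simp add: *)
  then have "f (p * q) = f p * q + p * f q" for p q
    by meson
  with f show ?thesis by (simp add: is_derivation_def)
qed

lemma is_derivation_pd: "is_derivation (pd v)"
proof (rule is_derivation_on_monomials[OF linear_pd])
  fix m m' :: "'a \<Rightarrow>\<^sub>0 nat"
  let ?v = "Poly_Mapping.single v 1 :: 'a \<Rightarrow>\<^sub>0 nat"
  have 1: "Poly_Mapping.single (m + m' - ?v) (real (Poly_Mapping.lookup m v))
      = Poly_Mapping.single (m - ?v + m') (real (Poly_Mapping.lookup m v))"
  proof (cases "Poly_Mapping.lookup m v = 0")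
    case False
    then have "m + m' - ?v = m - ?v + m'"
      by (intro poly_mapping_eqI) (auto simp: lookup_minus lookup_add lookup_single when_def)
    then show ?thesis by simp
  qed simp
  have 2: "Poly_Mapping.single (m + m' - ?v) (real (Poly_Mapping.lookup m' v))
      = Poly_Mapping.single (m + (m' - ?v)) (real (Poly_Mapping.lookup m' v))"
  proof (cases "Poly_Mapping.lookup m' v = 0")
    case False
    then have "m + m' - ?v = m + (m' - ?v)"
      by (intro poly_mapping_eqI) (auto simp: lookup_minus lookup_add lookup_single when_def)
    then show ?thesis by simp
  qed simp
  show "pd v (Poly_Mapping.single (m + m') 1) = pd v (Poly_Mapping.single m 1) * Poly_Mapping.single m' 1
      + Poly_Mapping.single m 1 * pd v (Poly_Mapping.single m' 1)"
    using 1 2 by (simp add: pd_single mult_single lookup_add single_add)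
qed


lemma is_derivation_1:
  fixes f :: "'a::real_algebra_1 \<Rightarrow> 'a"
  assumes "is_derivation f"
  shows "f 1 = 0"
  using is_derivationD(7)[OF assms, of 1 1] by simp

lemma is_derivation_scale:
  fixes f :: "'a::{real_algebra, comm_ring} \<Rightarrow> 'a"
  shows "is_derivation f \<Longrightarrow> is_derivation (\<lambda>p. c *\<^sub>R (a * f p))"
  unfolding is_derivation_def linear_iff by (auto simp: algebra_simps)

lemma is_derivation_Sum_any:
  assumes f: "\<And>k. is_derivation (f k)" and fin: "\<And>p. finite {k. f k p \<noteq> 0}"
  shows "is_derivation (\<lambda>p. Sum_any (\<lambda>k. f k p))"
proof -
  have "Sum_any (\<lambda>k. f k (p + q)) = Sum_any (\<lambda>k. f k p) + Sum_any (\<lambda>k. f k q)" for p q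
    using f by (simp add: is_derivationD Sum_any.distrib fin)
  moreover have "Sum_any (\<lambda>k. f k (c *\<^sub>R p)) = c *\<^sub>R Sum_any (\<lambda>k. f k p)" for c p
    using f by (simp add: is_derivationD Sum_any.expand_superset[OF fin[of p]] scaleR_sum_right
        subset_eq)
  moreover have "Sum_any (\<lambda>k. f k (p * q)) = Sum_any (\<lambda>k. f k p) * q + p * Sum_any (\<lambda>k. f k q)" for p q
  proof -
    have 1: "finite {k. f k p * q \<noteq> 0}" by (rule finite_subset[OF _ fin[of p]]) auto
    have 2: "finite {k. p * f k q \<noteq> 0}" by (rule finite_subset[OF _ fin[of q]]) auto
    show ?thesis
      using f by (simp add: is_derivationD Sum_any.distrib 1 2 Sum_any_left_distrib
          Sum_any_right_distrib fin)
  qed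
  ultimately show ?thesis
    by (simp add: is_derivation_def linear_iff)
qed

lemma derivation_eq_on_generators:
  fixes f g :: "(('v \<Rightarrow>\<^sub>0 nat) \<Rightarrow>\<^sub>0 real) \<Rightarrow> ('v \<Rightarrow>\<^sub>0 nat) \<Rightarrow>\<^sub>0 real"
  assumes f: "is_derivation f" and g: "is_derivation g" and eq: "\<And>v. f (X v) = g (X v)"
  shows "f = g"
proof (rule linear_eq_mpoly[OF is_derivationD(1)[OF f] is_derivationD(1)[OF g]])
  fix m
  show "f (Poly_Mapping.single m 1) = g (Poly_Mapping.single m 1)"
  proof (induction m rule: update_induct)
    case const
    then show ?case using is_derivation_1[OF f] is_derivation_1[OF g] by simp
  next
    case (update m v n)
    have pow: "f (X v ^ j) = g (X v ^ j)" for j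
      by (induction j) (simp_all add: is_derivation_1 f g is_derivationD(7) eq)
    have powX: "X v ^ j = Poly_Mapping.single (Poly_Mapping.single v j) 1" for j
      by (induction j) (simp_all add: X_def mult_single flip: single_add)
    have "Poly_Mapping.update v n m = m + Poly_Mapping.single v n"
      using update(1) by (intro poly_mapping_eqI)
        (auto simp: lookup_update lookup_add lookup_single in_keys_iff when_def)
    then have "Poly_Mapping.single (Poly_Mapping.update v n m) (1::real) =
        Poly_Mapping.single m 1 * X v ^ n"
      by (simp add: powX mult_single)
    then show ?case
      by (simp add: is_derivationD(7) f g pow update.IH)
  qed
qed

lemma Abs_nonzero_index_eq:
  "m \<noteq> 0 \<Longrightarrow> n \<noteq> 0 \<Longrightarrow> Abs_nonzero_index m = Abs_nonzero_index n \<longleftrightarrow> m = n"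
  by (simp add: Abs_nonzero_index_inject)

lemma finite_pd: "finite {v. pd v p \<noteq> 0}"
proof (rule finite_subset)
  show "{v. pd v p \<noteq> 0} \<subseteq> (\<Union>m\<in>Poly_Mapping.keys p. Poly_Mapping.keys m)"
    unfolding pd_def by (auto simp: in_keys_iff intro!: sum.neutral)
qed simp

lemma finite_D_op_0: "finite {k. real (k + 1) *\<^sub>R (zk (k + 1) * pd (Inl k) p) \<noteq> 0}"
proof (rule finite_subset)
  show "{k. real (k + 1) *\<^sub>R (zk (k + 1) * pd (Inl k) p) \<noteq> 0} \<subseteq> Inl -` {v. pd v p \<noteq> 0}"
    by auto
  show "finite (Inl -` {v. pd v p \<noteq> 0})"
    by (rule finite_vimageI[OF finite_pd]) simp
qed

lemma finite_D_op: "finite {n. D_op n p \<noteq> 0}"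
proof (rule finite_subset)
  let ?A = "(\<lambda>n. Inr (Abs_nonzero_index n)) -` {v. pd v p \<noteq> 0} \<inter> {n. n \<noteq> 0}"
  show "{n. D_op n p \<noteq> 0} \<subseteq> insert 0 ?A"
    by (auto simp: D_op_def)
  show "finite (insert 0 ?A)"
    by (intro finite.insertI finite_vimage_IntI finite_pd)
      (auto simp: inj_on_def Abs_nonzero_index_eq)
qed

lemma finite_partial_op: "finite {n. real (n $ i + 1) *\<^sub>R (zn (n + axis i 1) * D_op n p) \<noteq> 0}"
  by (rule finite_subset[OF _ finite_D_op[of p]]) auto

lemma is_derivation_D_op: "is_derivation (D_op n)"
proof (cases "n = 0")
  case True
  have "is_derivation (\<lambda>p :: 'a mpoly. Sum_any (\<lambda>k. real (k + 1) *\<^sub>R (zk (k + 1) * pd (Inl k) p)))"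
    by (rule is_derivation_Sum_any[OF is_derivation_scale[OF is_derivation_pd] finite_D_op_0])
  then show ?thesis unfolding D_op_def using True by simp
next
  case False
  then show ?thesis unfolding D_op_def by (simp add: is_derivation_pd)
qed

lemma is_derivation_partial_op: "is_derivation (partial_op i)"
  unfolding partial_op_def
  by (rule is_derivation_Sum_any[OF is_derivation_scale[OF is_derivation_D_op] finite_partial_op])

lemma is_derivation_generator_op: "is_derivation (generator_op b)"
  by (cases b) (simp_all add: generator_op_def is_derivation_D_op is_derivation_partial_op)

lemma Sum_any_single_term:
  assumes "\<And>k. k \<noteq> a \<Longrightarrow> f k = 0"
  shows "Sum_any f = f a"
proof -
  have "{k. f k \<noteq> 0} \<subseteq> {a}" using assms by auto
  then show ?thesis by (subst Sum_any.expand_superset[of "{a}"]) auto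
qed

lemma axis_eq_0: "i \<noteq> j \<Longrightarrow> axis i x $ j = 0"
  by (simp add: axis_def)

lemma D_op_zk: "D_op n (zk k) = (if n = 0 then real (k + 1) *\<^sub>R zk (k + 1) else 0)"
proof (cases "n = 0")
  case True
  then show ?thesis
    unfolding D_op_def by (subst Sum_any_single_term[of k]) (auto simp: zk_def pd_X)
qed (auto simp: D_op_def zk_def pd_X)

lemma D_op_zn: "m \<noteq> 0 \<Longrightarrow> D_op n (zn m) = (if n = m then 1 else 0)"
  by (auto simp: D_op_def zn_def pd_X Abs_nonzero_index_eq)

lemma axis_nonzero: "n + axis i 1 \<noteq> (0 :: nat ^ 'd)" "axis i 1 + n \<noteq> (0 :: nat ^ 'd)"
  "axis i 1 \<noteq> (0 :: nat ^ 'd)"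
  by (auto simp: vec_eq_iff axis_def)

lemma partial_op_zk: "partial_op i (zk k) = real (k + 1) *\<^sub>R (zn (axis i 1) * zk (k + 1))"
  unfolding partial_op_def by (subst Sum_any_single_term[of 0]) (auto simp: D_op_zk)

lemma partial_op_zn: "m \<noteq> 0 \<Longrightarrow> partial_op i (zn m) = real (m $ i + 1) *\<^sub>R zn (m + axis i 1)"
  unfolding partial_op_def by (subst Sum_any_single_term[of m]) (auto simp: D_op_zn)

lemma derivation_eq_zk_zn:
  assumes "is_derivation f" "is_derivation g"
    "\<And>k. f (zk k) = g (zk k)" "\<And>m. m \<noteq> 0 \<Longrightarrow> f (zn m) = g (zn m)"
  shows "f = g"
proof (rule derivation_eq_on_generators[OF assms(1,2)])
  show "f (X v) = g (X v)" for v
  proof (cases v)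
    case (Inl k)
    then show ?thesis using assms(3)[of k] by (simp add: zk_def)
  next
    case (Inr n)
    then show ?thesis using assms(4)[of "Rep_nonzero_index n"] Rep_nonzero_index[of n]
      by (simp add: zn_def Rep_nonzero_index_inverse)
  qed
qed

lemma is_derivation_0: "is_derivation (0 :: 'a::real_algebra \<Rightarrow> 'a)"
  using subspace_0[OF subspace_derivations] by simp

lemma is_derivation_scaleR:
  "is_derivation f \<Longrightarrow> is_derivation (c *\<^sub>R (f :: 'a::real_algebra \<Rightarrow> 'a))"
  using subspace_scale[OF subspace_derivations] by simp

lemmas derivation_rules = is_derivation_0 is_derivation_scaleR is_derivation_commutator
  is_derivation_D_op is_derivation_partial_op
lemmas D_op_simps = is_derivationD(2-7)[OF is_derivation_D_op] is_derivation_1[OF is_derivation_D_op]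
lemmas partial_op_simps = is_derivationD(2-7)[OF is_derivation_partial_op]
  is_derivation_1[OF is_derivation_partial_op]

lemma D_op_D_op: "(D_op n \<circ> D_op n') - (D_op n' \<circ> D_op n) = 0"
  by (rule derivation_eq_zk_zn; (intro derivation_rules)?)
    (auto simp: D_op_simps D_op_zk D_op_zn)

lemma partial_op_partial_op: "(partial_op i \<circ> partial_op j) - (partial_op j \<circ> partial_op i) = 0"
proof (rule derivation_eq_zk_zn; (intro derivation_rules)?)
  have ax: "(axis i 1 :: nat ^ 'a) $ j = (axis j 1 :: nat ^ 'a) $ i"
    by (simp add: axis_def)
  show "((partial_op i \<circ> partial_op j) - (partial_op j \<circ> partial_op i)) (zk k) = 0 (zk k)" for k
    by (simp add: partial_op_simps partial_op_zk partial_op_zn axis_nonzero ax algebra_simps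
        del: One_nat_def)
  show "((partial_op i \<circ> partial_op j) - (partial_op j \<circ> partial_op i)) (zn m) = 0 (zn m)"
    if "m \<noteq> 0" for m
    using that
    by (cases "i = j") (simp_all add: partial_op_simps partial_op_zn axis_nonzero add_ac axis_eq_0
        del: One_nat_def)
qed

lemma minus_axis_eq_iff:
  fixes n m :: "nat ^ 'd"
  assumes "n $ i \<noteq> 0"
  shows "n - axis i 1 = m \<longleftrightarrow> n = m + axis i 1"
  using assms by (auto simp: vec_eq_iff axis_def)

lemma partial_op_D_op:
  "(partial_op i \<circ> D_op n) - (D_op n \<circ> partial_op i) = - real (n $ i) *\<^sub>R D_op (n - axis i 1)"
proof (rule derivation_eq_zk_zn; (intro derivation_rules)?)
  have n0: "n = axis i 1" if "n $ i \<noteq> 0" "n - axis i 1 = 0"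
    using minus_axis_eq_iff[OF that(1), of 0] that(2) by simp
  show "((partial_op i \<circ> D_op n) - (D_op n \<circ> partial_op i)) (zk k)
      = (- real (n $ i) *\<^sub>R D_op (n - axis i 1)) (zk k)" for k
    using n0
    by (cases "n $ i = 0"; cases "n = 0"; auto simp: D_op_simps partial_op_simps partial_op_zk D_op_zk D_op_zn axis_nonzero)
  show "((partial_op i \<circ> D_op n) - (D_op n \<circ> partial_op i)) (zn m)
      = (- real (n $ i) *\<^sub>R D_op (n - axis i 1)) (zn m)" if "m \<noteq> 0" for m
  proof (cases "n $ i = 0")
    case True
    then have "n \<noteq> m + axis i 1" by (auto simp: axis_def)
    then show ?thesis using True that
      by (auto simp: D_op_simps partial_op_simps partial_op_zn D_op_zn axis_nonzero simp del: One_nat_def)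
  next
    case False
    then have "n - axis i 1 = m \<longleftrightarrow> n = m + axis i 1" by (rule minus_axis_eq_iff)
    moreover have "n $ i = Suc (m $ i)" if "n = m + axis i 1" using that by simp
    ultimately show ?thesis using that
      by (auto simp: D_op_simps partial_op_simps partial_op_zn D_op_zn axis_nonzero simp del: One_nat_def)
  qed
qed

subsection \<open>The Lie algebra of derivations spanned by the generators\<close>

typedef (overloaded) ('d::finite) drv =
  "span (range (generator_op :: 'd + (nat ^ 'd) \<Rightarrow> 'd mpoly \<Rightarrow> 'd mpoly))"
  morphisms drv_apply Abs_drv
  using span_zero by blast

setup_lifting type_definition_drv

instantiation drv :: (finite) real_vector
begin

lift_definition zero_drv :: "'a drv" is 0 by (rule span_zero)
lift_definition plus_drv :: "'a drv \<Rightarrow> 'a drv \<Rightarrow> 'a drv" is "(+)" by (rule span_add)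
lift_definition minus_drv :: "'a drv \<Rightarrow> 'a drv \<Rightarrow> 'a drv" is "(-)" by (rule span_diff)
lift_definition uminus_drv :: "'a drv \<Rightarrow> 'a drv" is uminus by (rule span_neg)
lift_definition scaleR_drv :: "real \<Rightarrow> 'a drv \<Rightarrow> 'a drv" is scaleR by (rule span_scale)

instance
  by standard (transfer; simp add: algebra_simps)+

end

lemma is_derivation_span: "f \<in> span (range generator_op) \<Longrightarrow> is_derivation f"
  using span_minimal[OF _ subspace_derivations, of "range generator_op"] is_derivation_generator_op
  by blast

lemma generator_commutator:
  "(generator_op b \<circ> generator_op c) - (generator_op c \<circ> generator_op b) \<in> span (range generator_op)"
proof -
  have D: "D_op n \<in> span (range generator_op)" for n :: "nat ^ 'a"
    by (rule span_base) (metis generator_op_def old.sum.simps(6) rangeI)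
  have *: "(partial_op i \<circ> D_op n) - (D_op n \<circ> partial_op i) \<in> span (range generator_op)"
    for i and n :: "nat ^ 'a"
    unfolding partial_op_D_op by (intro span_scale D)
  have "(D_op n \<circ> partial_op i) - (partial_op i \<circ> D_op n) \<in> span (range generator_op)"
    for i and n :: "nat ^ 'a"
    using span_neg[OF *[of i n]] by (simp only: minus_diff_eq)
  with * show ?thesis
    by (cases b; cases c) (simp_all add: generator_op_def D_op_D_op partial_op_partial_op span_zero)
qed

lemma span_commutator:
  fixes f g :: "('d::finite) mpoly \<Rightarrow> 'd mpoly"
  assumes f: "f \<in> span (range generator_op)" and g: "g \<in> span (range generator_op)"
  shows "(f \<circ> g) - (g \<circ> f) \<in> span (range generator_op)"
proof -
  let ?S = "span (range (generator_op :: 'd + (nat ^ 'd) \<Rightarrow> 'd mpoly \<Rightarrow> 'd mpoly))"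
  have lin: "subspace {f \<in> ?S. (f \<circ> g) - (g \<circ> f) \<in> ?S}" if "is_derivation g" for g :: "'d mpoly \<Rightarrow> 'd mpoly"
    unfolding subspace_def
  proof (intro conjI ballI allI; clarsimp)
    show "0 \<in> ?S \<and> (0 \<circ> g) - (g \<circ> 0) \<in> ?S"
    proof -
      have "(0 \<circ> g) - (g \<circ> 0) = 0" by (auto simp: fun_eq_iff is_derivationD[OF that])
      then show ?thesis by (simp add: span_zero)
    qed
  next
    fix f f' assume "f \<in> ?S" "(f \<circ> g) - (g \<circ> f) \<in> ?S" "f' \<in> ?S" "(f' \<circ> g) - (g \<circ> f') \<in> ?S"
    moreover have "((f + f') \<circ> g) - (g \<circ> (f + f')) = ((f \<circ> g) - (g \<circ> f)) + ((f' \<circ> g) - (g \<circ> f'))"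
      by (auto simp: fun_eq_iff is_derivationD[OF that])
    ultimately show "f + f' \<in> ?S \<and> ((f + f') \<circ> g) - (g \<circ> (f + f')) \<in> ?S"
      by (simp only: span_add)
  next
    fix c f assume "f \<in> ?S" "(f \<circ> g) - (g \<circ> f) \<in> ?S"
    moreover have "((c *\<^sub>R f) \<circ> g) - (g \<circ> (c *\<^sub>R f)) = c *\<^sub>R ((f \<circ> g) - (g \<circ> f))"
      by (auto simp: fun_eq_iff is_derivationD[OF that] scaleR_diff_right)
    ultimately show "c *\<^sub>R f \<in> ?S \<and> ((c *\<^sub>R f) \<circ> g) - (g \<circ> (c *\<^sub>R f)) \<in> ?S"
      by (simp only: span_scale)
  qed
  have 1: "f \<in> {f \<in> ?S. (f \<circ> generator_op c) - (generator_op c \<circ> f) \<in> ?S}" if "f \<in> ?S" for f c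
    by (rule subsetD[OF span_minimal[OF _ lin[OF is_derivation_generator_op]] that])
      (auto intro: span_base generator_commutator)
  have "g \<in> {g \<in> ?S. (g \<circ> f) - (f \<circ> g) \<in> ?S}"
  proof (rule subsetD[OF span_minimal[OF _ lin[OF is_derivation_span[OF f]]] g], safe)
    fix c
    show "generator_op c \<in> ?S" by (simp add: span_base)
    have "- ((f \<circ> generator_op c) - (generator_op c \<circ> f)) \<in> ?S"
      using 1[OF f, of c] span_neg by blast
    then show "(generator_op c \<circ> f) - (f \<circ> generator_op c) \<in> ?S" by (simp only: minus_diff_eq)
  qed
  then have "- ((g \<circ> f) - (f \<circ> g)) \<in> ?S" using span_neg by blast
  then show ?thesis by (simp only: minus_diff_eq)
qed

lift_definition drv_commutator :: "('d::finite) drv \<Rightarrow> 'd drv \<Rightarrow> 'd drv"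
  is "\<lambda>f g. (f \<circ> g) - (g \<circ> f)"
  by (rule span_commutator)

lift_definition generator :: "'d + (nat ^ 'd) \<Rightarrow> ('d::finite) drv" is generator_op
  by (simp add: span_base)

abbreviation partial :: "'d \<Rightarrow> ('d::finite) drv" where
  "partial i \<equiv> generator (Inl i)"

abbreviation D :: "nat ^ 'd \<Rightarrow> ('d::finite) drv" where
  "D n \<equiv> generator (Inr n)"

lemma generator_op_separation:
  fixes b :: "'d::finite + (nat ^ 'd)"
  obtains p m k where "k \<noteq> 0"
    "\<And>c. Poly_Mapping.lookup (generator_op c p) m = (if c = b then k else 0)"
proof -
  have zn: "Poly_Mapping.lookup (zn n) M = (1 when Poly_Mapping.single (Inr (Abs_nonzero_index n)) 1 = M)"
    for n :: "nat ^ 'd" and M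
    by (simp add: zn_def X_def lookup_single)
  have zk: "Poly_Mapping.lookup (zk k) M = (1 when Poly_Mapping.single (Inl k) 1 = M)"
    for k and M :: "'d var \<Rightarrow>\<^sub>0 nat"
    by (simp add: zk_def X_def lookup_single)
  have znk: "Poly_Mapping.lookup (zn n * zk k) M =
      (1 when Poly_Mapping.single (Inr (Abs_nonzero_index n)) 1 + Poly_Mapping.single (Inl k) 1 = M)"
    for n :: "nat ^ 'd" and k M
    by (simp add: zn_def zk_def X_def mult_single lookup_single)
  have single1: "Poly_Mapping.single v 1 = Poly_Mapping.single w (1::nat) \<longleftrightarrow> v = w"
      "Poly_Mapping.single v 1 \<noteq> (0 :: 'd var \<Rightarrow>\<^sub>0 nat)" for v w :: "'d var"
    by (auto simp: poly_mapping_eq_iff fun_eq_iff lookup_single when_def split: if_splits)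
  consider i where "b = Inl i" | n where "b = Inr n" "n \<noteq> 0" | "b = Inr 0"
    by (cases b) auto
  then show ?thesis
  proof cases
    case (1 i)
    define m :: "nat ^ 'd" where "m = (\<chi> i. 1)"
    have m: "m \<noteq> 0" by (simp add: m_def vec_eq_iff)
    have ne: "axis j 1 = (axis i 1 :: nat ^ 'd) \<longleftrightarrow> j = i" for j
      by (auto simp: axis_def vec_eq_iff)
    have "Poly_Mapping.lookup (generator_op c (zn m))
        (Poly_Mapping.single (Inr (Abs_nonzero_index (m + axis i 1))) 1) =
        (if c = b then real (m $ i + 1) else 0)" for c
      by (cases c)
        (auto simp: generator_op_def partial_op_zn D_op_zn m 1 zn when_def single1 lookup_one
          Abs_nonzero_index_eq axis_nonzero ne simp del: One_nat_def)
    then show ?thesis by (rule that[rotated]) simp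
  next
    case (2 n)
    have "Poly_Mapping.lookup (generator_op c (zn n)) 0 = (if c = b then 1 else 0)" for c
      by (cases c) (auto simp: generator_op_def partial_op_zn D_op_zn 2 zn when_def single1 simp del: One_nat_def)
    then show ?thesis by (rule that[rotated]) simp
  next
    case 3
    have ne: "Poly_Mapping.single (Inr v) 1 + Poly_Mapping.single (Inl k) 1
        \<noteq> Poly_Mapping.single (Inl l) (1::nat)" for k l and v :: "'d nonzero_index"
      by (auto simp: poly_mapping_eq_iff fun_eq_iff lookup_add lookup_single when_def intro!: exI[of _ "Inr v"])
    have "Poly_Mapping.lookup (generator_op c (zk 0)) (Poly_Mapping.single (Inl 1) 1)
        = (if c = b then 1 else 0)" for c
      by (cases c) (auto simp: generator_op_def partial_op_zk D_op_zk 3 zk znk when_def ne single1 simp del: One_nat_def)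
    then show ?thesis by (rule that[rotated]) simp
  qed
qed

lemma drv_apply_sum: "drv_apply (sum f A) = (\<Sum>x\<in>A. drv_apply (f x))"
  by (induction A rule: infinite_finite_induct) (simp_all add: zero_drv.rep_eq plus_drv.rep_eq)

lemma sum_fun_apply: "(sum f A) x = (\<Sum>y\<in>A. f y x)"
  by (induction A rule: infinite_finite_induct) simp_all

lemma inj_generator: "inj generator"
proof (rule injI)
  fix b c :: "'a + (nat ^ 'a)"
  assume "generator b = generator c"
  then have "generator_op b = generator_op c" by transfer
  then show "b = c" by (metis generator_op_separation)
qed

lemma independent_generator: "independent (range generator)"
  unfolding independent_explicit_module
proof (intro allI impI)
  fix S :: "'a drv set" and u x
  assume S: "finite S" "S \<subseteq> range generator" "(\<Sum>v\<in>S. u v *\<^sub>R v) = 0" "x \<in> S"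
  then obtain b where b: "x = generator b" by blast
  obtain p m k where k: "k \<noteq> 0"
      and sep: "\<And>c. Poly_Mapping.lookup (generator_op c p) m = (if c = b then k else 0)"
    by (rule generator_op_separation[of b]) blast
  have "0 = Poly_Mapping.lookup (drv_apply (\<Sum>v\<in>S. u v *\<^sub>R v) p) m"
    using S(3) by (simp add: zero_drv.rep_eq)
  also have "\<dots> = (\<Sum>v\<in>S. u v * Poly_Mapping.lookup (drv_apply v p) m)"
    by (simp add: drv_apply_sum sum_fun_apply lookup_sum scaleR_drv.rep_eq)
  also have "\<dots> = (\<Sum>v\<in>S. if v = x then u x * k else 0)"
  proof (rule sum.cong)
    fix v assume "v \<in> S"
    then obtain c where "v = generator c" using S(2) by blast
    then show "u v * Poly_Mapping.lookup (drv_apply v p) m = (if v = x then u x * k else 0)"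
      using sep[of c] by (auto simp: b generator.rep_eq inj_eq[OF inj_generator])
  qed simp
  also have "\<dots> = u x * k" using S(1,4) by simp
  finally show "u x = 0" using k by simp
qed

text \<open>Since \<^const>\<open>generator\<close> is an injectively indexed basis, \<^const>\<open>construct\<close> gives the
  bilinear extension of the table.\<close>

fun dia_basis :: "'d + (nat ^ 'd) \<Rightarrow> 'd + (nat ^ 'd) \<Rightarrow> ('d::finite) drv" where
  "dia_basis (Inr n) (Inr n') = 0"
| "dia_basis (Inl i) (Inl j) = 0"
| "dia_basis (Inr n) (Inl i) = 0"
| "dia_basis (Inl i) (Inr n) = (if n $ i = 0 then 0 else - real (n $ i) *\<^sub>R D (n - axis i 1))"

definition dia_drv :: "('d::finite) drv \<Rightarrow> 'd drv \<Rightarrow> 'd drv" where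
  "dia_drv x y = construct (range generator) (\<lambda>b. construct (range generator)
     (\<lambda>c. dia_basis (inv generator b) (inv generator c)) y) x"

lemma dia_drv_generator: "dia_drv (generator b) (generator c) = dia_basis b c"
  unfolding dia_drv_def
  by (simp add: construct_basis[OF independent_generator] inv_f_f[OF inj_generator])

lemma bilinear_dia_drv: "bilinear dia_drv"
proof -
  let ?c = "construct (range (generator :: 'a + (nat ^ 'a) \<Rightarrow> _))"
  have 1: "linear (?c f)" for f :: "'a drv \<Rightarrow> 'a drv"
    by (rule linear_construct[OF independent_generator])
  have "linear (\<lambda>y. ?c (\<lambda>b. ?c (f b) y) x)" for f :: "'a drv \<Rightarrow> 'a drv \<Rightarrow> 'a drv" and x
    by (auto simp: linear_iff linear_add[OF 1] linear_cmul[OF 1]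
        construct_add[OF independent_generator] construct_scale[OF independent_generator])
  then show ?thesis unfolding bilinear_def dia_drv_def by (intro conjI allI 1)
qed

section \<open>The operations on the tensor product\<close>

text \<open>Each operation is the unique bilinear one with the prescribed values on pure tensors; see
  \<open>AD_tri_tensor\<close>, \<open>AD_br_tensor\<close>, \<open>AD_dia_tensor\<close> and the accompanying bilinearity lemmas.\<close>

type_synonym 'd AD = "('d mpoly, 'd drv) tensor"

definition AD_tri :: "('d::finite) AD \<Rightarrow> 'd AD \<Rightarrow> 'd AD" where
  "AD_tri = tensor_lift2 (\<lambda>a1 D1 a2 D2. (a1 * drv_apply D1 a2) \<otimes> D2)"

definition AD_br :: "('d::finite) AD \<Rightarrow> 'd AD \<Rightarrow> 'd AD" where
  "AD_br = tensor_lift2 (\<lambda>a1 D1 a2 D2. (a1 * a2) \<otimes> drv_commutator D1 D2)"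

definition AD_dia :: "('d::finite) AD \<Rightarrow> 'd AD \<Rightarrow> 'd AD" where
  "AD_dia = tensor_lift2 (\<lambda>a1 D1 a2 D2. (a1 * a2) \<otimes> dia_drv D1 D2)"

lemma bilinear_drv_commutator: "bilinear drv_commutator"
proof -
  have "is_derivation (drv_apply x)" for x :: "'a drv"
    using drv_apply is_derivation_span by blast
  note simps = is_derivationD[OF this]
  show ?thesis
    unfolding bilinear_def linear_iff
    by (auto simp: drv_apply_inject[symmetric] drv_commutator.rep_eq plus_drv.rep_eq
        scaleR_drv.rep_eq fun_eq_iff simps scaleR_diff_right)
qed

lemmas bilinear_simps = bilinear_ladd[OF bilinear_tensor_of] bilinear_radd[OF bilinear_tensor_of]
  bilinear_lmul[OF bilinear_tensor_of] bilinear_rmul[OF bilinear_tensor_of]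

lemma tri_bilinear_aux:
  "bilinear (\<lambda>a1 D1. (a1 * drv_apply D1 a2) \<otimes> (D2 :: ('d::finite) drv))"
  "bilinear (\<lambda>a2 D2. (a1 * drv_apply D1 a2) \<otimes> (D2 :: ('d::finite) drv))"
proof -
  have "is_derivation (drv_apply D1)"
    using drv_apply is_derivation_span by blast
  note simps = is_derivationD(2,6)[OF this]
  show "bilinear (\<lambda>a1 D1. (a1 * drv_apply D1 a2) \<otimes> (D2 :: 'd drv))"
    "bilinear (\<lambda>a2 D2. (a1 * drv_apply D1 a2) \<otimes> (D2 :: 'd drv))"
    by (simp_all add: bilinear_def linear_iff bilinear_simps ring_distribs plus_drv.rep_eq
        scaleR_drv.rep_eq simps)
qed

lemma product_bilinear_aux:
  fixes g :: "('d::finite) drv \<Rightarrow> 'd drv \<Rightarrow> 'd drv"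
  assumes "bilinear g"
  shows "bilinear (\<lambda>a1 D1. (a1 * a2 :: 'd mpoly) \<otimes> g D1 D2)"
    "bilinear (\<lambda>a2 D2. (a1 * a2 :: 'd mpoly) \<otimes> g D1 D2)"
  by (simp_all add: bilinear_def linear_iff bilinear_simps ring_distribs
      bilinear_ladd[OF assms] bilinear_radd[OF assms] bilinear_lmul[OF assms] bilinear_rmul[OF assms])

lemma bilinear_AD_tri: "bilinear AD_tri"
  and AD_tri_tensor: "AD_tri (a1 \<otimes> D1) (a2 \<otimes> D2) = (a1 * drv_apply D1 a2) \<otimes> D2"
  unfolding AD_tri_def
  by (rule bilinear_tensor_lift2[OF tri_bilinear_aux])
    (rule tensor_lift2_of[where f = "\<lambda>a1 D1 a2 D2. (a1 * drv_apply D1 a2) \<otimes> D2", OF tri_bilinear_aux])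

lemma bilinear_AD_br: "bilinear AD_br"
  and AD_br_tensor: "AD_br (a1 \<otimes> D1) (a2 \<otimes> D2) = (a1 * a2) \<otimes> drv_commutator D1 D2"
  unfolding AD_br_def
  by (rule bilinear_tensor_lift2[OF product_bilinear_aux[OF bilinear_drv_commutator]])
    (rule tensor_lift2_of[where f = "\<lambda>a1 D1 a2 D2. (a1 * a2) \<otimes> drv_commutator D1 D2",
        OF product_bilinear_aux[OF bilinear_drv_commutator]])

lemma bilinear_AD_dia: "bilinear AD_dia"
  and AD_dia_tensor: "AD_dia (a1 \<otimes> D1) (a2 \<otimes> D2) = (a1 * a2) \<otimes> dia_drv D1 D2"
  unfolding AD_dia_def
  by (rule bilinear_tensor_lift2[OF product_bilinear_aux[OF bilinear_dia_drv]])
    (rule tensor_lift2_of[where f = "\<lambda>a1 D1 a2 D2. (a1 * a2) \<otimes> dia_drv D1 D2",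
        OF product_bilinear_aux[OF bilinear_dia_drv]])

definition L0 :: "('d::finite) AD set" where
  "L0 = span (range (\<lambda>i. 1 \<otimes> partial i) \<union> {zmon \<gamma> \<otimes> D n | \<gamma> n. True})"

end

(* The operation dia is antisymmetrised to the commutator on the generators, hence
   [x, y] = dia x y - dia y x on all of the tensor product: the torsion vanishes and the deformed
   bracket is 0. Null curvature holds since the D n act trivially from the left while the actions
   of the partial i commute. A deformation with zero bracket is pre-Lie. *)

theory Submission
  imports Defs
begin

section \<open>Geometric deformations and subalgebras\<close>

lemma bilinear_op_on_UNIV: "bilinear f \<Longrightarrow> bilinear_op_on UNIV f"
  by (simp add: bilinear_op_on_def bilinear_ladd bilinear_radd bilinear_lmul bilinear_rmul)

lemma bilinear_op_on_subset:
  assumes "bilinear_op_on L f" "subspace M" "M \<subseteq> L" "\<And>x y. x \<in> M \<Longrightarrow> y \<in> M \<Longrightarrow> f x y \<in> M"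
  shows "bilinear_op_on M f"
  using assms unfolding bilinear_op_on_def by (simp add: subset_iff)

lemma sub_post_lie_imp_post_lie_on:
  assumes "sub_post_lie M L tri br"
  shows "post_lie_on M tri br"
proof -
  have L: "post_lie_on L tri br" and M: "subspace M" "M \<subseteq> L"
    and closed: "\<And>x y. x \<in> M \<Longrightarrow> y \<in> M \<Longrightarrow> tri x y \<in> M" "\<And>x y. x \<in> M \<Longrightarrow> y \<in> M \<Longrightarrow> br x y \<in> M"
    using assms by (auto simp: sub_post_lie_def)
  then have "bilinear_op_on M tri" "bilinear_op_on M br"
    by (auto simp: post_lie_on_def lie_bracket_on_def intro: bilinear_op_on_subset[of L])
  with L M show ?thesis
    unfolding post_lie_on_def lie_bracket_on_def by (simp add: subset_iff)
qed

text \<open>Every condition is an identity between elements of \<open>L\<close>, so it restricts.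
  Closure under \<open>dia\<close> is assumed separately, since \<open>sub_post_lie\<close> speaks
  only of \<open>tri\<close> and \<open>br\<close>.\<close>

lemma geometric_deformation_subset:
  assumes L: "geometric_deformation L tri br dia tri' br'" and M: "sub_post_lie M L tri br"
    and dia: "\<And>x y. x \<in> M \<Longrightarrow> y \<in> M \<Longrightarrow> dia x y \<in> M"
  shows "geometric_deformation M tri br dia tri' br'"
proof -
  have "subspace M" "M \<subseteq> L" using M by (auto simp: sub_post_lie_def)
  moreover from this have "bilinear_op_on M dia"
    using L dia by (auto simp: geometric_deformation_def intro: bilinear_op_on_subset[of L])
  ultimately show ?thesis
    using L sub_post_lie_imp_post_lie_on[OF M] unfolding geometric_deformation_def
    by (simp add: subset_iff)
qed

text \<open>Zero deformed bracket means that \<open>br\<close> is the commutator of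
  \<open>dia\<close>. Antisymmetrise the associator of \<open>tri'\<close> in \<open>x\<close> and
  \<open>y\<close>: the post-Lie identity and null curvature produce \<open>tri (br x y) z\<close>
  and \<open>dia (br x y) z\<close>, which cancel against the terms with \<open>dia x y\<close> and
  \<open>dia y x\<close> in the left slot. The mixed terms cancel because \<open>tri\<close> acts on
  \<open>dia\<close> by derivations.\<close>

lemma geometric_deformation_imp_pre_lie_on:
  assumes "geometric_deformation L tri br dia tri' (\<lambda>_ _. 0)"
  shows "pre_lie_on L tri'"
proof -
  have tri: "bilinear_op_on L tri" and dia: "bilinear_op_on L dia"
    and post: "\<And>x y z. x \<in> L \<Longrightarrow> y \<in> L \<Longrightarrow> z \<in> L \<Longrightarrow>
      tri (br x y) z = associator tri x y z - associator tri y x z"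
    and flat: "\<And>x y z. x \<in> L \<Longrightarrow> y \<in> L \<Longrightarrow> z \<in> L \<Longrightarrow>
      dia x (dia y z) - dia y (dia x z) - dia (br x y) z = 0"
    and der: "\<And>x y z. x \<in> L \<Longrightarrow> y \<in> L \<Longrightarrow> z \<in> L \<Longrightarrow>
      tri x (dia y z) = dia (tri x y) z + dia y (tri x z)"
    and tri': "\<And>x y. x \<in> L \<Longrightarrow> y \<in> L \<Longrightarrow> tri' x y = tri x y + dia x y"
    and commutator: "\<And>x y. x \<in> L \<Longrightarrow> y \<in> L \<Longrightarrow> 0 = br x y - commutator dia x y"
    and br: "bilinear_op_on L br"
    using assms unfolding geometric_deformation_def post_lie_on_def lie_bracket_on_def by blast+
  have br_closed: "\<And>x y. x \<in> L \<Longrightarrow> y \<in> L \<Longrightarrow> br x y \<in> L"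
    using br by (simp add: bilinear_op_on_def)
  have dia_eq: "\<And>x y. x \<in> L \<Longrightarrow> y \<in> L \<Longrightarrow> dia x y = br x y + dia y x"
    using commutator by (simp add: commutator_def)
  have L: "subspace L" using tri by (simp add: bilinear_op_on_def)
  have closed: "\<And>x y. x \<in> L \<Longrightarrow> y \<in> L \<Longrightarrow> tri x y \<in> L" "\<And>x y. x \<in> L \<Longrightarrow> y \<in> L \<Longrightarrow> dia x y \<in> L"
    "\<And>x y. x \<in> L \<Longrightarrow> y \<in> L \<Longrightarrow> x + y \<in> L" "\<And>c x. x \<in> L \<Longrightarrow> c *\<^sub>R x \<in> L"
    using tri dia L by (auto simp: bilinear_op_on_def subspace_add subspace_scale)
  have add: "tri (x + y) z = tri x z + tri y z" "tri z (x + y) = tri z x + tri z y"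
    "dia (x + y) z = dia x z + dia y z" "dia z (x + y) = dia z x + dia z y"
    if "x \<in> L" "y \<in> L" "z \<in> L" for x y z
    using tri dia that by (simp_all add: bilinear_op_on_def)
  have scale: "tri (c *\<^sub>R x) y = c *\<^sub>R tri x y" "tri x (c *\<^sub>R y) = c *\<^sub>R tri x y"
    "dia (c *\<^sub>R x) y = c *\<^sub>R dia x y" "dia x (c *\<^sub>R y) = c *\<^sub>R dia x y"
    if "x \<in> L" "y \<in> L" for c x y
    using tri dia that by (simp_all add: bilinear_op_on_def)
  have "bilinear_op_on L tri'"
    using L by (simp add: bilinear_op_on_def tri' closed add scale algebra_simps)
  moreover have "associator tri' x y z = associator tri' y x z" if "x \<in> L" "y \<in> L" "z \<in> L" for x y z
  proof -
    \<comment> \<open>The swap is instantiated at the fixed pair, so that rewriting does not turn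
      \<open>dia y x\<close> back.\<close>
    have "tri (dia x y) z = tri (br x y) z + tri (dia y x) z"
      and "dia (dia x y) z = dia (br x y) z + dia (dia y x) z"
      using that by (simp_all add: dia_eq[of x y] add br_closed closed)
    with post[of x y z] flat[of x y z] der[of x y z] der[of y x z] that show ?thesis
      by (simp add: associator_def tri' closed add algebra_simps)
  qed
  ultimately show ?thesis by (simp add: pre_lie_on_def)
qed

section \<open>The derivations\<close>

lemma is_derivation_drv_apply: "is_derivation (drv_apply x)"
  using drv_apply is_derivation_span by blast

lemmas drv_apply_simps = is_derivationD(2-7)[OF is_derivation_drv_apply]
  is_derivation_1[OF is_derivation_drv_apply]

lemma drv_commutator_apply:
  "drv_apply (drv_commutator x y) p = drv_apply x (drv_apply y p) - drv_apply y (drv_apply x p)"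
  by (simp add: drv_commutator.rep_eq)

lemma drv_eqI: "(\<And>p. drv_apply x p = drv_apply y p) \<Longrightarrow> x = y"
  by (simp add: drv_apply_inject[symmetric] fun_eq_iff)

lemma drv_commutator_antisym: "drv_commutator x y = - drv_commutator y x"
  by (rule drv_eqI) (simp add: uminus_drv.rep_eq drv_commutator_apply)

lemma drv_commutator_jacobi:
  "drv_commutator x (drv_commutator y z) + drv_commutator y (drv_commutator z x)
     + drv_commutator z (drv_commutator x y) = 0"
  by (rule drv_eqI) (simp add: plus_drv.rep_eq zero_drv.rep_eq drv_commutator_apply drv_apply_simps)

section \<open>The generators span the Lie algebra of derivations\<close>

lemma Abs_drv_add:
  "f \<in> span (range generator_op) \<Longrightarrow> g \<in> span (range generator_op) \<Longrightarrow>
     Abs_drv (f + g) = Abs_drv f + Abs_drv g"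
  by (rule drv_eqI) (simp add: plus_drv.rep_eq Abs_drv_inverse span_add)

lemma Abs_drv_scaleR:
  "f \<in> span (range generator_op) \<Longrightarrow> Abs_drv (c *\<^sub>R f) = c *\<^sub>R Abs_drv f"
  by (rule drv_eqI) (simp add: scaleR_drv.rep_eq Abs_drv_inverse span_scale)

lemma span_generator: "span (range generator) = UNIV"
proof -
  \<comment> \<open>Membership of \<open>f\<close> is carried through the induction because
    \<open>Abs_drv\<close> is known to be linear only on the span.\<close>
  have "f \<in> span (range generator_op) \<and> Abs_drv f \<in> span (range generator)"
    if "f \<in> span (range generator_op)" for f :: "'a mpoly \<Rightarrow> 'a mpoly"
    using that
  proof (induction rule: span_induct_alt)
    case base
    show ?case by (simp add: span_zero flip: zero_drv_def zero_fun_def)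
  next
    case (step c g h)
    then obtain b where b: "g = generator_op b" by blast
    have "Abs_drv (generator_op b) = generator b"
      by (simp add: generator_def)
    moreover have "g \<in> span (range generator_op)" by (simp add: b span_base)
    moreover have "generator b \<in> span (range generator)" by (simp add: span_base)
    ultimately show ?case using step
      by (simp only: b Abs_drv_add Abs_drv_scaleR span_scale span_add simp_thms)
  qed
  then show ?thesis by (metis UNIV_eq_I drv_apply drv_apply_inverse)
qed

lemma drv_induct [case_names generator add scale]:
  assumes "\<And>b. P (generator b)" "\<And>x y. P x \<Longrightarrow> P y \<Longrightarrow> P (x + y)" "\<And>c x. P x \<Longrightarrow> P (c *\<^sub>R x)"
  shows "P (x :: ('d::finite) drv)"
proof -
  have "x \<in> span (range generator)" by (simp add: span_generator)
  then show ?thesis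
  proof (induction rule: span_induct_alt)
    case base
    \<comment> \<open>Zero is \<open>0\<close> times a generator, so the scaling case supplies
      it.\<close>
    show ?case using assms(3)[OF assms(1), of 0] by simp
  qed (auto intro: assms)
qed

text \<open>The only commutators that can be nonzero pair some \<open>partial i\<close> with some
  \<open>D n\<close>; there one of the two table entries is the commutator up to sign and the other
  is 0.\<close>

lemma drv_commutator_generator:
  "drv_commutator (generator b) (generator c) = dia_basis b c - dia_basis c b"
proof -
  have "drv_commutator (partial i) (D n) = - real (n $ i) *\<^sub>R D (n - axis i 1)" for i and n :: "nat ^ 'a"
    using partial_op_D_op[of i n]
    by (simp add: drv_apply_inject[symmetric] drv_commutator.rep_eq scaleR_drv.rep_eq
        uminus_drv.rep_eq generator.rep_eq generator_op_def)
  \<comment> \<open>For \<open>n $ i = 0\<close> the subtraction truncates to \<open>n\<close>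
    itself, but the coefficient is 0, as in the table.\<close>
  then have *: "drv_commutator (partial i) (D n) = dia_basis (Inl i) (Inr n)" for i and n :: "nat ^ 'a"
    by simp
  moreover have "drv_commutator (D n) (partial i) = - dia_basis (Inl i) (Inr n)" for i and n :: "nat ^ 'a"
    by (subst drv_commutator_antisym) (simp only: *)
  moreover have "drv_commutator (partial i) (partial j) = 0" for i j :: 'a
    using partial_op_partial_op[of i j]
    by (simp add: drv_apply_inject[symmetric] drv_commutator.rep_eq zero_drv.rep_eq generator.rep_eq
        generator_op_def)
  moreover have "drv_commutator (D n) (D m) = 0" for n m :: "nat ^ 'a"
    using D_op_D_op[of n m]
    by (simp add: drv_apply_inject[symmetric] drv_commutator.rep_eq zero_drv.rep_eq generator.rep_eq
        generator_op_def)
  ultimately show ?thesis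
    by (cases b; cases c) (simp_all del: dia_basis.simps(4))
qed

section \<open>Torsion and curvature of the operation on derivations\<close>

lemmas drv_bilinear_simps =
  bilinear_ladd[OF bilinear_dia_drv] bilinear_radd[OF bilinear_dia_drv]
  bilinear_lmul[OF bilinear_dia_drv] bilinear_rmul[OF bilinear_dia_drv]
  bilinear_lsub[OF bilinear_dia_drv] bilinear_rsub[OF bilinear_dia_drv]
  bilinear_lzero[OF bilinear_dia_drv] bilinear_rzero[OF bilinear_dia_drv]
  bilinear_lneg[OF bilinear_dia_drv] bilinear_rneg[OF bilinear_dia_drv]
  bilinear_ladd[OF bilinear_drv_commutator] bilinear_radd[OF bilinear_drv_commutator]
  bilinear_lmul[OF bilinear_drv_commutator] bilinear_rmul[OF bilinear_drv_commutator]

text \<open>Both sides are bilinear, so agreement on the generators suffices.\<close>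

lemma drv_commutator_eq_dia: "drv_commutator x y = dia_drv x y - dia_drv y x"
proof (induction x rule: drv_induct)
  case (generator b)
  show ?case
    by (induction y rule: drv_induct)
      (simp_all add: drv_bilinear_simps drv_commutator_generator dia_drv_generator
        scaleR_diff_right)
qed (simp_all add: drv_bilinear_simps scaleR_diff_right)

text \<open>On generators, commutators are 0 or multiples of some \<open>D n\<close>, which act as
  zero from the left, so the right side vanishes. On the left only two \<open>partial\<close>s
  acting on a \<open>D n\<close> survive, and these actions commute.\<close>

lemma dia_drv_flat:
  "dia_drv x (dia_drv y z) - dia_drv y (dia_drv x z) = dia_drv (drv_commutator x y) z"
proof (induction x rule: drv_induct)
  case (generator b)
  show ?case
  proof (induction y rule: drv_induct)
    case (generator c)
    show ?case
    proof (induction z rule: drv_induct)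
      case (generator e)
      have comm: "n - axis i 1 - axis j 1 = n - axis j 1 - axis i 1" for i j and n :: "nat ^ 'a"
        by (simp add: vec_eq_iff add.commute)
      \<comment> \<open>Removing the trivial case \<open>b = c\<close> leaves distinct directions
        \<open>i\<close> and \<open>j\<close>; lowering one coordinate then leaves the coefficient
        read off at the other unchanged.\<close>
      show ?case
      proof (cases "b = c")
        case False
        then show ?thesis
          by (cases b; cases c; cases e)
            (auto simp: dia_drv_generator drv_commutator_generator drv_bilinear_simps comm
              axis_eq_0 simp del: One_nat_def)
      qed (simp add: drv_commutator_generator drv_bilinear_simps)
    qed (simp_all add: drv_bilinear_simps algebra_simps flip: scaleR_diff_right)
  qed (simp_all add: drv_bilinear_simps algebra_simps flip: scaleR_diff_right)
qed (simp_all add: drv_bilinear_simps algebra_simps flip: scaleR_diff_right)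

section \<open>The tensor product\<close>

text \<open>Scalars are absorbed into the first tensor factor, so sums of pure tensors reach
  everything. The proof adds one key of a representative at a time.\<close>

lemma tensor_induct [case_names tensor add]:
  assumes "\<And>a b. P (a \<otimes> b)" "\<And>s t. P s \<Longrightarrow> P t \<Longrightarrow> P (s + t)"
  shows "P t"
proof (induct t rule: tensor.abs_induct)
  fix u :: "'a \<times> 'b \<Rightarrow>\<^sub>0 real"
  have single: "abs_tensor (Poly_Mapping.single (a, b) c) = (c *\<^sub>R a) \<otimes> b"
    for a :: 'a and b :: 'b and c
  proof -
    have "Poly_Mapping.single (a, b) c = c *\<^sub>R pure a b"
      by (rule poly_mapping_eqI) (simp add: pure_def lookup_single when_def)
    then have "abs_tensor (Poly_Mapping.single (a, b) c) = c *\<^sub>R (a \<otimes> b)"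
      by (simp add: tensor_of.abs_eq scaleR_tensor.abs_eq)
    then show ?thesis by (simp only: bilinear_lmul[OF bilinear_tensor_of])
  qed
  show "P (abs_tensor u)"
  proof (induction u rule: update_induct)
    case const
    show ?case using assms(1)[of 0 0]
      by (simp add: bilinear_lzero[OF bilinear_tensor_of] zero_tensor_def)
  next
    case (update m k c)
    \<comment> \<open>The key \<open>k\<close> is fresh for \<open>m\<close>, hence updating is
      adding.\<close>
    have "Poly_Mapping.update k c m = m + Poly_Mapping.single k c"
      using update(1) by (intro poly_mapping_eqI)
        (auto simp: lookup_update lookup_add lookup_single in_keys_iff when_def)
    moreover have "P (abs_tensor (Poly_Mapping.single k c))"
      using assms(1) single by (cases k) simp
    ultimately show ?case using assms(2) update.IH by (simp flip: plus_tensor.abs_eq)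
  qed
qed

section \<open>Identities on the tensor product, checked on pure tensors\<close>

lemmas AD_bilinear_simps =
  bilinear_ladd[OF bilinear_AD_tri] bilinear_radd[OF bilinear_AD_tri]
  bilinear_ladd[OF bilinear_AD_br] bilinear_radd[OF bilinear_AD_br]
  bilinear_ladd[OF bilinear_AD_dia] bilinear_radd[OF bilinear_AD_dia]

lemmas AD_tensor_simps = AD_tri_tensor AD_br_tensor AD_dia_tensor

lemmas tensor_simps = bilinear_simps bilinear_lsub[OF bilinear_tensor_of]
  bilinear_rsub[OF bilinear_tensor_of] bilinear_rneg[OF bilinear_tensor_of]
  bilinear_lzero[OF bilinear_tensor_of] bilinear_rzero[OF bilinear_tensor_of]

text \<open>Additivity in each slot is enough because \<open>tensor_induct\<close> has no scaling
  case. An identity is proved by taking \<open>T\<close> as the difference of its sides.\<close>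

lemma trilinear_eq_0_tensor:
  fixes T :: "('a::real_vector, 'b::real_vector) tensor \<Rightarrow> ('c::real_vector, 'd::real_vector) tensor
    \<Rightarrow> ('e::real_vector, 'f::real_vector) tensor \<Rightarrow> 'g::real_vector"
  assumes "\<And>a1 b1 a2 b2 a3 b3. T (a1 \<otimes> b1) (a2 \<otimes> b2) (a3 \<otimes> b3) = 0"
    and "\<And>x x' y z. T (x + x') y z = T x y z + T x' y z"
    and "\<And>x y y' z. T x (y + y') z = T x y z + T x y' z"
    and "\<And>x y z z'. T x y (z + z') = T x y z + T x y z'"
  shows "T x y z = 0"
proof (induction x rule: tensor_induct)
  case (tensor a1 b1)
  show ?case
  proof (induction y rule: tensor_induct)
    case (tensor a2 b2)
    show ?case by (induction z rule: tensor_induct) (simp_all add: assms)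
  qed (simp add: assms)
qed (simp add: assms)

text \<open>Commutativity of the polynomials reduces this to
  \<open>drv_commutator_eq_dia\<close>.\<close>

lemma AD_br_eq_dia: "AD_br x y = AD_dia x y - AD_dia y x"
proof (induction x rule: tensor_induct)
  case (tensor a b)
  show ?case
    by (induction y rule: tensor_induct)
      (simp_all add: AD_bilinear_simps AD_tensor_simps drv_commutator_eq_dia tensor_simps mult.commute)
qed (simp add: AD_bilinear_simps)

lemma AD_br_jacobi: "AD_br x (AD_br y z) + AD_br y (AD_br z x) + AD_br z (AD_br x y) = 0"
proof (rule trilinear_eq_0_tensor[where
      T = "\<lambda>x y z. AD_br x (AD_br y z) + AD_br y (AD_br z x) + AD_br z (AD_br x y)"])
  fix a1 a2 a3 :: "'a mpoly" and b1 b2 b3 :: "'a drv"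
  \<comment> \<open>The common polynomial factor is pulled out, leaving the Jacobi sum of the
    derivations.\<close>
  have "AD_br (a1 \<otimes> b1) (AD_br (a2 \<otimes> b2) (a3 \<otimes> b3)) + AD_br (a2 \<otimes> b2) (AD_br (a3 \<otimes> b3) (a1 \<otimes> b1))
      + AD_br (a3 \<otimes> b3) (AD_br (a1 \<otimes> b1) (a2 \<otimes> b2)) = (a1 * a2 * a3) \<otimes>
      (drv_commutator b1 (drv_commutator b2 b3) + drv_commutator b2 (drv_commutator b3 b1)
        + drv_commutator b3 (drv_commutator b1 b2))"
    by (simp add: AD_tensor_simps tensor_simps mult_ac)
  then show "AD_br (a1 \<otimes> b1) (AD_br (a2 \<otimes> b2) (a3 \<otimes> b3)) + AD_br (a2 \<otimes> b2) (AD_br (a3 \<otimes> b3) (a1 \<otimes> b1))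
      + AD_br (a3 \<otimes> b3) (AD_br (a1 \<otimes> b1) (a2 \<otimes> b2)) = 0"
    by (simp only: drv_commutator_jacobi tensor_simps)
qed (simp_all add: AD_bilinear_simps)

text \<open>\<open>AD_tri\<close> differentiates only the polynomial factor, so this is the Leibniz
  rule on a product of two polynomials.\<close>

lemma AD_tri_br: "AD_tri x (AD_br y z) = AD_br (AD_tri x y) z + AD_br y (AD_tri x z)"
proof -
  have "AD_tri x (AD_br y z) - (AD_br (AD_tri x y) z + AD_br y (AD_tri x z)) = 0"
    by (rule trilinear_eq_0_tensor[where T = "\<lambda>x y z. AD_tri x (AD_br y z) - (AD_br (AD_tri x y) z + AD_br y (AD_tri x z))"])
      (simp_all add: AD_bilinear_simps AD_tensor_simps drv_apply_simps tensor_simps algebra_simps)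
  then show ?thesis by simp
qed

text \<open>By the Leibniz rule the associator on pure tensors is
  \<open>(a1 * a2 * D1 (D2 a3)) \<otimes> D3\<close>; antisymmetrising gives the commutator applied
  to \<open>a3\<close>.\<close>

lemma AD_br_tri: "AD_tri (AD_br x y) z = associator AD_tri x y z - associator AD_tri y x z"
proof -
  have "AD_tri (AD_br x y) z - (associator AD_tri x y z - associator AD_tri y x z) = 0"
    by (rule trilinear_eq_0_tensor[where T = "\<lambda>x y z. AD_tri (AD_br x y) z - (associator AD_tri x y z - associator AD_tri y x z)"])
      (simp_all add: associator_def AD_bilinear_simps AD_tensor_simps drv_apply_simps drv_commutator_apply
        tensor_simps algebra_simps)
  then show ?thesis by simp
qed

lemma AD_tri_dia: "AD_tri x (AD_dia y z) = AD_dia (AD_tri x y) z + AD_dia y (AD_tri x z)"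
proof -
  have "AD_tri x (AD_dia y z) - (AD_dia (AD_tri x y) z + AD_dia y (AD_tri x z)) = 0"
    by (rule trilinear_eq_0_tensor[where T = "\<lambda>x y z. AD_tri x (AD_dia y z) - (AD_dia (AD_tri x y) z + AD_dia y (AD_tri x z))"])
      (simp_all add: AD_bilinear_simps AD_tensor_simps drv_apply_simps tensor_simps algebra_simps)
  then show ?thesis by simp
qed

lemma AD_dia_flat: "AD_dia x (AD_dia y z) - AD_dia y (AD_dia x z) = AD_dia (AD_br x y) z"
proof -
  have "AD_dia x (AD_dia y z) - AD_dia y (AD_dia x z) - (AD_dia (AD_br x y) z) = 0"
    by (rule trilinear_eq_0_tensor[where T = "\<lambda>x y z. AD_dia x (AD_dia y z) - AD_dia y (AD_dia x z) - (AD_dia (AD_br x y) z)"])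
      (simp_all add: AD_bilinear_simps AD_tensor_simps tensor_simps mult_ac flip: dia_drv_flat)
  then show ?thesis by simp
qed

section \<open>The post-Lie structure and its deformation\<close>

lemma post_lie_on_AD: "post_lie_on UNIV AD_tri AD_br"
  \<comment> \<open>The instance of \<open>AD_br_eq_dia\<close> at equal arguments makes the bracket
    alternating.\<close>
  by (simp add: post_lie_on_def lie_bracket_on_def bilinear_op_on_UNIV bilinear_AD_tri
      bilinear_AD_br AD_br_jacobi AD_tri_br AD_br_tri AD_br_eq_dia[of x x for x])

lemma geometric_deformation_AD:
  "geometric_deformation UNIV AD_tri AD_br AD_dia (AD_tri + AD_dia) (\<lambda>_ _. 0)"
proof -
  have "torsion AD_br AD_dia x y = 0" for x y :: "'a AD"
    by (simp add: torsion_def commutator_def AD_br_eq_dia)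
  then show ?thesis
    by (simp add: geometric_deformation_def post_lie_on_AD bilinear_op_on_UNIV bilinear_AD_dia
        AD_dia_flat AD_tri_dia commutator_def AD_br_eq_dia bilinear_rzero[OF bilinear_AD_dia])
qed

section \<open>The subalgebra\<close>

text \<open>Identifies the monomials with the basis used in \<open>mpoly_expand\<close>.\<close>

lemma zmon_eq_single: "zmon \<gamma> = Poly_Mapping.single \<gamma> 1"
proof -
  have pow: "X v ^ j = Poly_Mapping.single (Poly_Mapping.single v j) 1" for v :: 'a and j
    by (induction j) (simp_all add: X_def mult_single flip: single_add)
  have prod: "(\<Prod>v\<in>A. Poly_Mapping.single (g v) (1::real)) = Poly_Mapping.single (\<Sum>v\<in>A. g v) 1"
    for g :: "'a \<Rightarrow> 'a \<Rightarrow>\<^sub>0 nat" and A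
    by (induction A rule: infinite_finite_induct) (simp_all add: mult_single)
  have "(\<Sum>v\<in>Poly_Mapping.keys \<gamma>. Poly_Mapping.single v (Poly_Mapping.lookup \<gamma> v)) = \<gamma>"
    by (rule poly_mapping_eqI)
      (auto simp: lookup_sum lookup_single when_def in_keys_iff sum.delta')
  then show ?thesis by (simp add: zmon_def pow prod)
qed

lemma bilinear_closed_on_span:
  assumes f: "bilinear f" and S: "\<And>a b. a \<in> S \<Longrightarrow> b \<in> S \<Longrightarrow> f a b \<in> span S"
    and "x \<in> span S" "y \<in> span S"
  shows "f x y \<in> span S"
proof -
  have left: "f a y \<in> span S" if "a \<in> S" for a
    using \<open>y \<in> span S\<close>
  proof (induction rule: span_induct_alt)
    case (step c b z)
    then show ?case using S[OF that]
      by (simp add: bilinear_radd[OF f] bilinear_rmul[OF f] span_add span_scale)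
  qed (simp add: bilinear_rzero[OF f] span_zero)
  show ?thesis
    using \<open>x \<in> span S\<close>
  proof (induction rule: span_induct_alt)
    case (step c a z)
    then show ?case using left
      by (simp add: bilinear_ladd[OF f] bilinear_lmul[OF f] span_add span_scale)
  qed (simp add: bilinear_lzero[OF f] span_zero)
qed

text \<open>Expansion into monomials: \<open>L0\<close> restricts the polynomial factor only in
  front of the \<open>partial i\<close>.\<close>

lemma tensor_D_in_L0: "a \<otimes> D n \<in> L0"
proof -
  have "a \<otimes> D n = (\<Sum>m\<in>Poly_Mapping.keys a. Poly_Mapping.lookup a m *\<^sub>R (zmon m \<otimes> D n))"
  proof -
    have lin: "linear (\<lambda>a. a \<otimes> D n)" using bilinear_tensor_of by (auto simp: bilinear_def)
    show ?thesis
      by (subst mpoly_expand) (simp add: zmon_eq_single linear_sum[OF lin] linear_cmul[OF lin])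
  qed
  also have "\<dots> \<in> L0"
    unfolding L0_def by (intro span_sum span_scale span_base) auto
  finally show ?thesis .
qed

lemma AD_tensor_generator:
  "AD_tri (a1 \<otimes> generator b) (a2 \<otimes> generator c) = (a1 * drv_apply (generator b) a2) \<otimes> generator c"
  "AD_dia (a1 \<otimes> generator b) (a2 \<otimes> generator c) = (a1 * a2) \<otimes> dia_basis b c"
  by (simp_all add: AD_tensor_simps dia_drv_generator)

lemma AD_closed_on_L0:
  assumes "x \<in> L0" "y \<in> L0"
  shows "AD_tri x y \<in> L0" "AD_dia x y \<in> L0" "AD_br x y \<in> L0"
proof -
  have L0: "c *\<^sub>R t \<in> L0" "- t \<in> L0" if "t \<in> L0" for c and t :: "'a AD"
    using that unfolding L0_def by (auto simp: span_scale span_neg)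
  let ?S = "range (\<lambda>i. 1 \<otimes> partial i) \<union> {zmon \<gamma> \<otimes> D n | \<gamma> n. True} :: 'a AD set"
  have zero: "0 \<in> (L0 :: 'a AD set)" by (simp add: L0_def span_zero)
  \<comment> \<open>All table values are multiples of some \<open>D n\<close>, so any polynomial
    factor is allowed.\<close>
  have dia: "a \<otimes> dia_basis b c \<in> L0" for a :: "'a mpoly" and b c
    by (cases b; cases c) (auto simp: tensor_simps zero L0 tensor_D_in_L0 simp del: One_nat_def)
  have closed: "f x y \<in> L0" if "bilinear f" "\<And>x y. x \<in> ?S \<Longrightarrow> y \<in> ?S \<Longrightarrow> f x y \<in> L0" "x \<in> L0" "y \<in> L0"
    for f :: "'a AD \<Rightarrow> 'a AD \<Rightarrow> 'a AD" and x y
    using bilinear_closed_on_span[of f ?S x y] that unfolding L0_def by blast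
  \<comment> \<open>If the right argument is \<open>1 \<otimes> partial i\<close>, the result is 0
    since derivations kill 1; otherwise it ends in some \<open>D n\<close>.\<close>
  show "AD_tri x y \<in> L0"
    by (rule closed[OF bilinear_AD_tri _ assms])
      (auto simp: AD_tensor_generator drv_apply_simps tensor_simps zero tensor_D_in_L0)
  \<comment> \<open>Stated for arbitrary elements because the bracket uses both orders of the
    arguments.\<close>
  have dia: "AD_dia x y \<in> L0" if "x \<in> L0" "y \<in> L0" for x y :: "'a AD"
    by (rule closed[OF bilinear_AD_dia _ that])
      (auto simp: AD_tensor_generator dia simp del: dia_basis.simps)
  then show "AD_dia x y \<in> L0" using assms .
  show "AD_br x y \<in> L0"
    using dia[of x y] dia[of y x] assms by (simp add: AD_br_eq_dia L0_def span_diff)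
qed

theorem theorem4p3:
  "pre_lie_on (UNIV :: ('d::finite) AD set) (AD_tri + AD_dia) \<and>
   sub_pre_lie (L0 :: 'd AD set) UNIV (AD_tri + AD_dia) \<and>
   geometric_deformation (UNIV :: 'd AD set) AD_tri AD_br AD_dia (AD_tri + AD_dia) (\<lambda>_ _. 0) \<and>
   sub_post_lie (L0 :: 'd AD set) UNIV AD_tri AD_br \<and>
   geometric_deformation (L0 :: 'd AD set) AD_tri AD_br AD_dia (AD_tri + AD_dia) (\<lambda>_ _. 0)"
proof -
  have L0: "subspace L0" by (simp add: L0_def)
  have pre: "pre_lie_on (UNIV :: 'd AD set) (AD_tri + AD_dia)"
    by (rule geometric_deformation_imp_pre_lie_on[OF geometric_deformation_AD])
  have sub: "sub_post_lie (L0 :: 'd AD set) UNIV AD_tri AD_br"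
    by (simp add: sub_post_lie_def post_lie_on_AD L0 AD_closed_on_L0)
  have "sub_pre_lie (L0 :: 'd AD set) UNIV (AD_tri + AD_dia)"
    by (simp add: sub_pre_lie_def pre L0 AD_closed_on_L0 subspace_add)
  \<comment> \<open>The deformation on \<open>L0\<close> is the restriction of the one on the whole
    space.\<close>
  moreover have "geometric_deformation (L0 :: 'd AD set) AD_tri AD_br AD_dia (AD_tri + AD_dia) (\<lambda>_ _. 0)"
    by (rule geometric_deformation_subset[OF geometric_deformation_AD sub AD_closed_on_L0(2)])
  ultimately show ?thesis using pre sub geometric_deformation_AD by blast
qed

end
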